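(* For every integer $n\geq 5$, $\mathrm{Kin}(n)^-\in\mathcal{K}_{n-1}-\mathcal{K}_n$; that is, $\mathrm{Kin}(n)^-$ belongs to $\mathcal{K}_{n-1}$ but not to $\mathcal{K}_n$.
   Context: All matroids are finite. For a matroid $M$ with rank function $r$ and ground set $E(M)$, and an integer $n\geq 4$, the $n$-th Kinser inequality for a family $X_1,\dots,X_n$ of subsets of $E(M)$ is $$\sum_{i=3}^n r(X_i)+r(X_1\cup X_2)+r(X_1\cup X_3\cup X_n)+\sum_{i=4}^n r(X_2\cup X_{i-1}\cup X_i)\leq r(X_1\cup X_3)+r(X_1\cup X_n)+\sum_{i=3}^n r(X_2\cup X_i)+\sum_{i=4}^n r(X_{i-1}\cup X_i).$$ $\mathcal{K}_n$ is the class of matroids $M$ that satisfy the $n$-th Kinser inequality for all families $X_1,\dots,X_n$ of subsets of $E(M)$. Kinser matroids: let $r\geq 4$. Let $V_1,\dots,V_r$ be pairwise disjoint sets with $|V_1|=|V_3|=|V_4|=\cdots=|V_r|=r-2$ and $V_2=\{e,f\}$ of size $2$. Put $E=V_1\cup\cdots\cup V_r$ and $W=V_1\cup V_3\cup V_4\cup\cdots\cup V_r$ ($=E-V_2$). Define $A_1=W-(V_1\cup V_r)$, $A_3=W-(V_1\cup V_3)$, $A_i=W-(V_{i-1}\cup V_i)$ for $i\in\{4,\dots,r\}$, $A=E$, and $A'=V_2$. Let $M_{r+1}$ be the (rank $r+1$) transversal matroid on $E$ with presentation $(A_1,A_3,A_4,\dots,A_r,A,A')$, i.e. its independent sets are the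 partial transversals of this family. $\mathrm{Kin}(r)$ is the truncation of $M_{r+1}$ (its independent sets are the independent sets of $M_{r+1}$ of size at most $r$). The set $V_1\cup V_2$ is a circuit-hyperplane (a set that is both a circuit and a hyperplane) of $\mathrm{Kin}(r)$. $\mathrm{Kin}(r)^-$ is the matroid obtained from $\mathrm{Kin}(r)$ by relaxing $V_1\cup V_2$, i.e. the matroid whose bases are the bases of $\mathrm{Kin}(r)$ together with $V_1\cup V_2$. *)

theory Defs
  imports Main
begin

section \<open>Finite matroids\<close>

record 'a matroid =
  ground :: "'a set"
  indeps :: "'a set set"

definition is_matroid :: "'a matroid \<Rightarrow> bool" where
  "is_matroid M \<longleftrightarrow>
     finite (ground M) \<and>
     indeps M \<subseteq> Pow (ground M) \<and>
     {} \<in> indeps M \<and>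
     (\<forall>I J. I \<in> indeps M \<longrightarrow> J \<subseteq> I \<longrightarrow> J \<in> indeps M) \<and>
     (\<forall>I J. I \<in> indeps M \<longrightarrow> J \<in> indeps M \<longrightarrow> card I < card J \<longrightarrow>
        (\<exists>x \<in> J - I. insert x I \<in> indeps M))"

definition rank :: "'a matroid \<Rightarrow> 'a set \<Rightarrow> nat" where
  "rank M X = Max {card I | I. I \<in> indeps M \<and> I \<subseteq> X}"

definition bases :: "'a matroid \<Rightarrow> 'a set set" where
  "bases M = {B \<in> indeps M. \<forall>I \<in> indeps M. B \<subseteq> I \<longrightarrow> I = B}"

definition matroid_of_bases :: "'a set \<Rightarrow> 'a set set \<Rightarrow> 'a matroid" where
  "matroid_of_bases E \<B> = \<lparr>ground = E, indeps = {I. \<exists>B \<in> \<B>. I \<subseteq> B}\<rparr>"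

definition relaxation :: "'a matroid \<Rightarrow> 'a set \<Rightarrow> 'a matroid" where
  "relaxation M X = matroid_of_bases (ground M) (insert X (bases M))"

definition truncate_to :: "nat \<Rightarrow> 'a matroid \<Rightarrow> 'a matroid" where
  "truncate_to k M = \<lparr>ground = ground M, indeps = {I \<in> indeps M. card I \<le> k}\<rparr>"

definition partial_transversal :: "'i set \<Rightarrow> ('i \<Rightarrow> 'a set) \<Rightarrow> 'a set \<Rightarrow> bool" where
  "partial_transversal J A X \<longleftrightarrow>
     (\<exists>\<phi>. inj_on \<phi> X \<and> (\<forall>x \<in> X. \<phi> x \<in> J \<and> x \<in> A (\<phi> x)))"

definition transversal_matroid :: "'a set \<Rightarrow> 'i set \<Rightarrow> ('i \<Rightarrow> 'a set) \<Rightarrow> 'a matroid" where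
  "transversal_matroid E J A =
     \<lparr>ground = E, indeps = {X. X \<subseteq> E \<and> partial_transversal J A X}\<rparr>"


section \<open>Kinser inequalities\<close>

text \<open>Both definitions are meant for \<open>n \<ge> 4\<close>. Only the values \<open>X 1, \<dots>, X n\<close> matter.\<close>

definition kinser_inequality :: "nat \<Rightarrow> 'a matroid \<Rightarrow> (nat \<Rightarrow> 'a set) \<Rightarrow> bool" where
  "kinser_inequality n M X \<longleftrightarrow>
     (\<Sum>i=3..n. rank M (X i)) + rank M (X 1 \<union> X 2) + rank M (X 1 \<union> X 3 \<union> X n)
       + (\<Sum>i=4..n. rank M (X 2 \<union> X (i - 1) \<union> X i))
     \<le> rank M (X 1 \<union> X 3) + rank M (X 1 \<union> X n) + (\<Sum>i=3..n. rank M (X 2 \<union> X i))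
       + (\<Sum>i=4..n. rank M (X (i - 1) \<union> X i))"

definition kinser_class :: "nat \<Rightarrow> 'a matroid set" where
  "kinser_class n =
     {M. is_matroid M \<and>
         (\<forall>X. (\<forall>i \<in> {1..n}. X i \<subseteq> ground M) \<longrightarrow> kinser_inequality n M X)}"


section \<open>Kinser matroids\<close>

text \<open>The blocks \<open>V 1, \<dots>, V r\<close> are arbitrary sets of the prescribed sizes; a different choice of
  blocks gives an isomorphic matroid.\<close>

definition kinser_blocks :: "nat \<Rightarrow> (nat \<Rightarrow> 'a set) \<Rightarrow> bool" where
  "kinser_blocks r V \<longleftrightarrow>
     (\<forall>i \<in> {1..r}. finite (V i)) \<and>
     (\<forall>i \<in> {1..r}. \<forall>j \<in> {1..r}. i \<noteq> j \<longrightarrow> V i \<inter> V j = {}) \<and>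
     card (V 2) = 2 \<and>
     (\<forall>i \<in> {1..r} - {2}. card (V i) = r - 2)"

lemma kinser_blocks_exist: "\<exists>V :: nat \<Rightarrow> (nat \<times> nat) set. kinser_blocks r V"
  by (rule exI[of _ "\<lambda>i. {i} \<times> {..<if i = 2 then 2 else r - 2}"])
     (auto simp: kinser_blocks_def)

definition kin_ground :: "nat \<Rightarrow> (nat \<Rightarrow> 'a set) \<Rightarrow> 'a set" where
  "kin_ground r V = (\<Union>i \<in> {1..r}. V i)"

text \<open>The presentation \<open>(A\<^sub>1, A\<^sub>3, A\<^sub>4, \<dots>, A\<^sub>r, A, A')\<close> is indexed by \<open>{0..r}\<close>: the two
  unused indices \<open>0\<close> and \<open>2\<close> carry \<open>A = E\<close> and \<open>A' = V\<^sub>2\<close>.\<close>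

definition kin_presentation :: "nat \<Rightarrow> (nat \<Rightarrow> 'a set) \<Rightarrow> nat \<Rightarrow> 'a set" where
  "kin_presentation r V i =
     (let W = kin_ground r V - V 2 in
      if i = 0 then kin_ground r V
      else if i = 1 then W - (V 1 \<union> V r)
      else if i = 2 then V 2
      else if i = 3 then W - (V 1 \<union> V 3)
      else W - (V (i - 1) \<union> V i))"

definition Kin :: "nat \<Rightarrow> (nat \<Rightarrow> 'a set) \<Rightarrow> 'a matroid" where
  "Kin r V = truncate_to r (transversal_matroid (kin_ground r V) {0..r} (kin_presentation r V))"

definition Kin_minus :: "nat \<Rightarrow> (nat \<Rightarrow> 'a set) \<Rightarrow> 'a matroid" where
  "Kin_minus r V = relaxation (Kin r V) (V 1 \<union> V 2)"

end

theory Submission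
  imports Defs
begin

text \<open>
  The relaxed matroid is a paving matroid: all sets of fewer than \<open>n\<close> elements are independent, and a
  set of \<open>n\<close> elements is independent unless it lies in some \<open>V c \<union> V d\<close> where \<open>c\<close>, \<open>d\<close> is an edge of a
  graph on the block indices. The graph is a wheel with one spoke missing: its rim is the cycle
  \<open>1, 3, 4, \<dots>, n\<close>, its hub is \<open>2\<close>, and the missing spoke \<open>1, 2\<close> is what the relaxation removes
  (lemma \<open>Kin_minus_eq\<close>, which rests on Hall's theorem). Ranks are therefore explicit: the rank of a
  set is its cardinality if this is less than \<open>n\<close>, and otherwise \<open>n - 1\<close> or \<open>n\<close> according to whether
  the set lies in one of these hyperplanes.

  Write \<open>A\<close> for the second set, \<open>C\<close> for the first and \<open>x\<^sub>0, \<dots>, x\<^sub>k\<close> for the others. With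
  \<open>I(X; Y | Z) = r (X \<union> Z) + r (Y \<union> Z) - r Z - r (X \<union> Y \<union> Z)\<close>, the difference of the two sides of the
  Kinser inequality (the \<open>slack\<close>) is
  \<open>I(A; C | {}) - I(A; x\<^sub>0 | {}) + I(x\<^sub>0; x\<^sub>k | C) + (\<Sum>i=1..k. I(A; x\<^sub>i\<^sub>-\<^sub>1 | x\<^sub>i))\<close>.
  For the blocks themselves all the ranks are known and the slack is \<open>-1\<close>, so the \<open>n\<close>-th inequality
  fails. The terms on the larger side correspond to the edges of the wheel, and the point
  is that no shorter closed walk can reproduce this.

  Take a violation with as few sets \<open>x\<^sub>i\<close> as possible. Submodularity alone shows that \<open>x\<^sub>i\<close> can be
  dropped when one of its neighbours lies in the closure of \<open>A \<union> x\<^sub>i\<close>, and that there is no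
  violation at all when \<open>A\<close> and some \<open>x\<^sub>i\<close> have a common part of rank \<open>I(A; x\<^sub>i | {})\<close> (lemmas
  \<open>slack_drop\<close> and \<open>slack_nonneg_if_common\<close>). In the paving matroid this forces each \<open>A \<union> x\<^sub>i\<close> to be
  large and to lie in a hyperplane, with different hyperplanes for consecutive \<open>i\<close>. Hence \<open>A\<close> lies in
  a single block \<open>V c\<close>, and each \<open>x\<^sub>i\<close> in an edge of the wheel at \<open>c\<close>
  (\<open>shortest_violation_on_edges\<close>). Comparing the slack before and after dropping an interior \<open>x\<^sub>i\<close> shows
  that consecutive sets are whole blocks that form an edge; as triangles of the wheel contain the hub,
  \<open>c = 2\<close> and the \<open>x\<^sub>i\<close> walk along the rim (\<open>shortest_violation_rim_path\<close>). Walking is neutral, so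
  everything is decided at the two ends: there the inequality can only fail if \<open>C\<close> lies in \<open>V 1\<close> and
  the walk leads from \<open>V 3\<close> to \<open>V n\<close> (\<open>end_inequality\<close>). That takes \<open>n - 2\<close> sets, one more than the
  inequality of index \<open>n - 1\<close> has.
\<close>

section \<open>The Kinser inequality for a submodular set function\<close>

text \<open>The single axiom packs monotonicity (take \<open>Y = Z\<close>) and submodularity (take \<open>Z = X \<inter> Y\<close> and
  \<open>W = X \<union> Y\<close>) into a form in which intersections never have to be computed.\<close>

locale submodular_rank =
  fixes r :: "'a set \<Rightarrow> int"
  assumes submod: "Z \<subseteq> X \<Longrightarrow> Z \<subseteq> Y \<Longrightarrow> W \<subseteq> X \<union> Y \<Longrightarrow> r W + r Z \<le> r X + r Y"
begin

lemma r_mono: "W \<subseteq> X \<Longrightarrow> r W \<le> r X"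
  using submod[of W X W W] by simp

text \<open>The part of the Kinser inequality that is additive along the sequence \<open>X\<^sub>3, \<dots>, X\<^sub>m\<close>: nodes
  contribute \<open>r (A \<union> x) - r x\<close> and consecutive pairs contribute \<open>r (x \<union> y) - r (A \<union> x \<union> y)\<close>.\<close>

fun fan :: "'a set \<Rightarrow> 'a set list \<Rightarrow> int" where
  "fan A [] = 0"
| "fan A [x] = r (A \<union> x) - r x"
| "fan A (x # y # L) = r (A \<union> x) - r x + (r (x \<union> y) - r (A \<union> x \<union> y)) + fan A (y # L)"

text \<open>Right-hand side minus left-hand side of the Kinser inequality for \<open>X\<^sub>1 = C\<close>, \<open>X\<^sub>2 = A\<close> and
  \<open>L = [X\<^sub>3, \<dots>, X\<^sub>m]\<close>; see \<open>kinser_inequality_iff_slack\<close>.\<close>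

definition slack :: "'a set \<Rightarrow> 'a set \<Rightarrow> 'a set list \<Rightarrow> int" where
  "slack A C L = fan A L + r (hd L \<union> C) + r (last L \<union> C) - r (hd L \<union> last L \<union> C) - r (A \<union> C)"

lemma fan_append:
  "fan A (xs @ x # ys) = fan A (xs @ [x]) + fan A (x # ys) - (r (A \<union> x) - r x)"
proof (induction xs)
  case Nil
  then show ?case by simp
next
  case (Cons a xs)
  then show ?case by (cases xs) auto
qed

lemma fan_rev: "fan A (rev L) = fan A L"
proof (induction A L rule: fan.induct)
  case (3 A x y L)
  have "fan A (rev (x # y # L)) = fan A (rev L @ y # [x])" by simp
  also have "\<dots> = fan A (rev (y # L)) + fan A [y, x] - (r (A \<union> y) - r y)"
    by (subst fan_append) simp
  finally show ?case using 3 by (simp add: Un_ac)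
qed auto

text \<open>The inequality is symmetric under a reflection of the cycle \<open>X\<^sub>1, X\<^sub>3, \<dots>, X\<^sub>m\<close> that fixes \<open>X\<^sub>1\<close>.\<close>

lemma slack_rev: "L \<noteq> [] \<Longrightarrow> slack A C (rev L) = slack A C L"
  by (simp add: slack_def fan_rev hd_rev last_rev Un_ac)

lemma slack_singleton: "slack A C [x] \<ge> 0"
proof -
  have "r (A \<union> C) + r x \<le> r (A \<union> x) + r (x \<union> C)" by (rule submod) auto
  then show ?thesis by (simp add: slack_def)
qed

text \<open>The hypothesis says that \<open>y\<close> lies in the closure of \<open>A \<union> x\<close>. Then the terms with \<open>A\<close> cancel
  and what remains is submodularity applied to \<open>x\<close>, \<open>y\<close>, \<open>C\<close> and the last set.\<close>

lemma slack_drop_end: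
  assumes "r (A \<union> x \<union> y) = r (A \<union> x)"
  shows "slack A C (y # L) \<le> slack A C (x # y # L)"
proof -
  let ?l = "last (y # L)"
  have "r (x \<union> y \<union> C) + r x \<le> r (x \<union> y) + r (x \<union> C)" by (rule submod) auto
  moreover have "r (x \<union> y \<union> ?l \<union> C) + r (y \<union> C) \<le> r (x \<union> y \<union> C) + r (y \<union> ?l \<union> C)"
    by (rule submod) auto
  moreover have "r (x \<union> ?l \<union> C) \<le> r (x \<union> y \<union> ?l \<union> C)" by (rule r_mono) auto
  ultimately show ?thesis using assms by (simp add: slack_def)
qed

text \<open>Only the terms next to \<open>y\<close> change when \<open>y\<close> is dropped, and the hypothesis compares them.\<close>

lemma slack_drop_interior:
  assumes "r (x \<union> z) - r (A \<union> x \<union> z)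
    \<le> r (x \<union> y) - r (A \<union> x \<union> y) + (r (A \<union> y) - r y) + (r (y \<union> z) - r (A \<union> y \<union> z))"
  shows "slack A C (xs @ x # z # zs) \<le> slack A C (xs @ x # y # z # zs)"
proof -
  have "fan A (xs @ x # z # zs) \<le> fan A (xs @ x # y # z # zs)"
    using assms fan_append[of A xs x "z # zs"] fan_append[of A xs x "y # z # zs"] by simp
  moreover have "hd (xs @ x # z # zs) = hd (xs @ x # y # z # zs)" by (cases xs) auto
  ultimately show ?thesis by (simp add: slack_def)
qed

text \<open>As \<open>x\<close> lies in the closure of \<open>A \<union> y\<close>, dropping \<open>y\<close> lowers the slack at
  least by the amount by which the marginal rank of \<open>y\<close> over \<open>x \<union> z\<close> decreases when \<open>A\<close> is added, and
  by submodularity this is not negative.\<close>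

lemma slack_drop_interior_closure:
  assumes "r (A \<union> x \<union> y) = r (A \<union> y)"
  shows "slack A C (xs @ x # z # zs) \<le> slack A C (xs @ x # y # z # zs)"
proof (rule slack_drop_interior)
  have "r (x \<union> y \<union> z) + r y \<le> r (x \<union> y) + r (y \<union> z)" by (rule submod) auto
  moreover have "r (A \<union> x \<union> y \<union> z) + r (x \<union> z) \<le> r (x \<union> y \<union> z) + r (A \<union> x \<union> z)"
    by (rule submod) auto
  moreover have "r (A \<union> y \<union> z) \<le> r (A \<union> x \<union> y \<union> z)" by (rule r_mono) auto
  ultimately show "r (x \<union> z) - r (A \<union> x \<union> z)
    \<le> r (x \<union> y) - r (A \<union> x \<union> y) + (r (A \<union> y) - r y) + (r (y \<union> z) - r (A \<union> y \<union> z))"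
    using assms by linarith
qed

text \<open>A member of the list is redundant if together with \<open>A\<close> it spans one of its neighbours. By
  reversal it suffices to drop the second of two neighbours, at the end of the list or in its interior.\<close>

lemma slack_drop:
  assumes "r (A \<union> x \<union> y) = r (A \<union> x) \<or> r (A \<union> x \<union> y) = r (A \<union> y)"
    and L: "L = xs @ x # y # ys"
  shows "\<exists>L'. L' \<noteq> [] \<and> length L' < length L \<and> set L' \<subseteq> set L \<and> slack A C L' \<le> slack A C L"
proof -
  have *: "\<exists>L'. L' \<noteq> [] \<and> length L' < length L \<and> set L' \<subseteq> set L \<and> slack A C L' \<le> slack A C L"
    if "r (A \<union> x \<union> y) = r (A \<union> y)" "L = xs @ x # y # ys" for L x y xs ys
  proof (cases ys)
    case Nil
    have "slack A C (x # rev xs) \<le> slack A C (y # x # rev xs)"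
      by (rule slack_drop_end) (use that(1) in \<open>simp add: Un_ac\<close>)
    then have "slack A C (xs @ [x]) \<le> slack A C L"
      using slack_rev[of "xs @ [x]" A C] slack_rev[of "xs @ [x, y]" A C] that(2) Nil by simp
    then show ?thesis unfolding that(2) Nil by (intro exI[of _ "xs @ [x]"]) auto
  next
    case (Cons z zs)
    have "slack A C (xs @ x # z # zs) \<le> slack A C (xs @ x # y # z # zs)"
      by (rule slack_drop_interior_closure) (fact that(1))
    then show ?thesis unfolding that(2) Cons by (intro exI[of _ "xs @ x # z # zs"]) auto
  qed
  show ?thesis
  proof (cases "r (A \<union> x \<union> y) = r (A \<union> y)")
    case True
    then show ?thesis using * L by blast
  next
    case False
    then have "r (A \<union> y \<union> x) = r (A \<union> x)" using assms by (simp add: Un_ac)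
    moreover have "rev L = rev ys @ y # x # rev xs" by (simp add: L)
    ultimately have "\<exists>L'. L' \<noteq> [] \<and> length L' < length (rev L) \<and> set L' \<subseteq> set (rev L) \<and>
        slack A C L' \<le> slack A C (rev L)" by (rule *)
    moreover have "slack A C (rev L) = slack A C L" by (rule slack_rev) (simp add: L)
    ultimately show ?thesis by simp
  qed
qed

text \<open>A part \<open>Z\<close> of the closure of \<open>A\<close> can become new, from one set to the next, only at the
  expense of \<open>I(A; x | y)\<close>: the quantity \<open>r (Z \<union> y) - r y\<close> exceeds \<open>r (Z \<union> x) - r x\<close> by at most that.\<close>

lemma fan_common:
  assumes "r (A \<union> Z) = r A"
  shows "r (Z \<union> last (x # ys)) - r (last (x # ys))
    \<le> r (Z \<union> x) - r x + fan A (x # ys) - (r (A \<union> x) - r x)"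
proof (induction ys arbitrary: x)
  case Nil
  then show ?case by simp
next
  case (Cons y ys)
  have 1: "r (x \<union> y \<union> Z) + r x \<le> r (Z \<union> x) + r (x \<union> y)" by (rule submod) auto
  have 2: "r (A \<union> x \<union> y) + r (Z \<union> y) \<le> r (x \<union> y \<union> Z) + r (A \<union> y \<union> Z)" by (rule submod) auto
  have 3: "r (A \<union> y \<union> Z) + r A \<le> r (A \<union> Z) + r (A \<union> y)" by (rule submod) auto
  show ?case using Cons[of y] 1 2 3 assms by simp
qed

text \<open>The classical proof of the Kinser inequality for subspaces: there, \<open>Z\<close> is the
  intersection of the spans of \<open>A\<close> and \<open>x\<close>. Starting at \<open>x\<close>, where \<open>Z\<close> is not new, its
  conditional rank is followed to both ends of the list by \<open>fan_common\<close> and then compared with \<open>C\<close>.\<close>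

lemma slack_nonneg_if_common:
  assumes "r (A \<union> Z) = r A" "r (x \<union> Z) = r x" "r A + r x \<le> r (A \<union> x) + r Z"
  shows "slack A C (xs @ x # ys) \<ge> 0"
proof -
  let ?h = "hd (xs @ x # ys)" and ?l = "last (x # ys)"
  have h: "?h = last (x # rev xs)" by (cases xs) auto
  have "fan A (xs @ [x]) = fan A (x # rev xs)" using fan_rev[of A "xs @ [x]"] by simp
  then have fl: "r (Z \<union> ?h) - r ?h \<le> fan A (xs @ [x]) - (r (A \<union> x) - r x)"
    using fan_common[OF assms(1), of x "rev xs"] assms(2) h by (simp add: Un_ac)
  have fr: "r (Z \<union> ?l) - r ?l \<le> fan A (x # ys) - (r (A \<union> x) - r x)"
    using fan_common[OF assms(1), of x ys] assms(2) by (simp add: Un_ac)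
  have 1: "r (Z \<union> ?h \<union> C) + r ?h \<le> r (Z \<union> ?h) + r (?h \<union> C)" by (rule submod) auto
  have 2: "r (Z \<union> ?l \<union> C) + r ?l \<le> r (Z \<union> ?l) + r (?l \<union> C)" by (rule submod) auto
  have 3: "r (?h \<union> ?l \<union> C) + r (Z \<union> C) \<le> r (Z \<union> ?h \<union> C) + r (Z \<union> ?l \<union> C)" by (rule submod) auto
  have 4: "r (A \<union> C) + r Z \<le> r (A \<union> Z) + r (Z \<union> C)" by (rule submod) auto
  have "slack A C (xs @ x # ys) = fan A (xs @ [x]) + fan A (x # ys) - (r (A \<union> x) - r x)
     + r (?h \<union> C) + r (?l \<union> C) - r (?h \<union> ?l \<union> C) - r (A \<union> C)"
    unfolding slack_def by (subst fan_append) simp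
  then show ?thesis using fl fr 1 2 3 4 assms by linarith
qed

lemma fan_upt:
  assumes "a \<le> b"
  shows "fan A (map X [a..<Suc b]) = (\<Sum>i=a..b. r (A \<union> X i) - r (X i))
     + (\<Sum>i=Suc a..b. r (X (i - 1) \<union> X i) - r (A \<union> X (i - 1) \<union> X i))"
  using assms
proof (induction b rule: dec_induct)
  case base
  then show ?case by simp
next
  case (step b)
  have "map X [a..<Suc (Suc b)] = map X [a..<b] @ X b # [X (Suc b)]"
    using step by (simp add: upt_conv_Cons)
  moreover have "map X [a..<Suc b] = map X [a..<b] @ [X b]" using step by simp
  ultimately show ?case
    using step fan_append[of A "map X [a..<b]" "X b" "[X (Suc b)]"] by simp
qed

end

lemma kinser_inequality_iff_slack:
  fixes r :: "'a set \<Rightarrow> int"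
  assumes "submodular_rank r" and "m \<ge> 4" and "\<And>i. i \<in> {1..m} \<Longrightarrow> X i \<subseteq> E"
    and "\<And>S. S \<subseteq> E \<Longrightarrow> int (rank M S) = r S"
  shows "kinser_inequality m M X \<longleftrightarrow>
    submodular_rank.slack r (X 2) (X 1) (map X [3..<Suc m]) \<ge> 0"
proof -
  interpret submodular_rank r by fact
  have e [simp]: "X i \<subseteq> E" if "1 \<le> i" "i \<le> m" for i using assms(3) that by simp
  have e' [simp]: "X (i - Suc 0) \<subseteq> E" if "4 \<le> i" "i \<le> m" for i
    using e[of "i - 1"] that by simp
  have hl: "hd (map X [3..<Suc m]) = X 3" "last (map X [3..<Suc m]) = X m"
    using assms(2) by (auto simp: hd_map last_map upt_conv_Cons)
  have s: "int (\<Sum>i\<in>I. rank M (f i)) = (\<Sum>i\<in>I. r (f i))" if "\<And>i. i \<in> I \<Longrightarrow> f i \<subseteq> E" for I :: "nat set" and f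
    unfolding of_nat_sum by (rule sum.cong) (use assms(4) that in auto)
  have "kinser_inequality m M X \<longleftrightarrow> 
     int ((\<Sum>i=3..m. rank M (X i)) + rank M (X 1 \<union> X 2) + rank M (X 1 \<union> X 3 \<union> X m)
       + (\<Sum>i=4..m. rank M (X 2 \<union> X (i - 1) \<union> X i)))
     \<le> int (rank M (X 1 \<union> X 3) + rank M (X 1 \<union> X m) + (\<Sum>i=3..m. rank M (X 2 \<union> X i))
       + (\<Sum>i=4..m. rank M (X (i - 1) \<union> X i)))"
    unfolding kinser_inequality_def of_nat_le_iff ..
  also have "\<dots> \<longleftrightarrow> (\<Sum>i=3..m. r (X i)) + r (X 1 \<union> X 2) + r (X 1 \<union> X 3 \<union> X m)
       + (\<Sum>i=4..m. r (X 2 \<union> X (i - 1) \<union> X i))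
     \<le> r (X 1 \<union> X 3) + r (X 1 \<union> X m) + (\<Sum>i=3..m. r (X 2 \<union> X i))
       + (\<Sum>i=4..m. r (X (i - 1) \<union> X i))"
    unfolding of_nat_add using assms(2) by (subst (1 2 3 4) s) (simp_all add: assms(4))
  also have "\<dots> \<longleftrightarrow> slack (X 2) (X 1) (map X [3..<Suc m]) \<ge> 0"
    unfolding slack_def hl using assms(2)
    by (subst fan_upt) (auto simp: sum_subtractf Un_ac eval_nat_numeral)
  finally show ?thesis .
qed

section \<open>Hall's marriage theorem\<close>

text \<open>Either some proper nonempty subset is tight; then it is matched first, and the elements outside
  still satisfy the condition when the values of the tight set are removed. Or every proper nonempty
  subset has a value to spare; then any one element may take any value.\<close>

lemma hall:
  fixes N :: "'a \<Rightarrow> 'b set"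
  assumes "finite X" "\<And>x. x \<in> X \<Longrightarrow> finite (N x)"
    and "\<And>Y. Y \<subseteq> X \<Longrightarrow> card Y \<le> card (\<Union>(N ` Y))"
  shows "\<exists>\<phi>. inj_on \<phi> X \<and> (\<forall>x\<in>X. \<phi> x \<in> N x)"
  using assms
proof (induction "card X" arbitrary: X N rule: less_induct)
  case less
  note fin = less.prems(1,2) and hall = less.prems(3)
  have finU: "finite (\<Union>(N ` Y))" if "Y \<subseteq> X" for Y
    using fin that by (meson finite_UN_I finite_subset subsetD)
  show ?case
  proof (cases "\<exists>Y. Y \<subset> X \<and> Y \<noteq> {} \<and> card (\<Union>(N ` Y)) \<le> card Y")
    case True
    then obtain Y where Y: "Y \<subset> X" "Y \<noteq> {}" "card (\<Union>(N ` Y)) \<le> card Y" by blast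
    have finY: "finite Y" using Y(1) fin(1) finite_subset by blast
    have "\<exists>\<phi>. inj_on \<phi> Y \<and> (\<forall>x\<in>Y. \<phi> x \<in> N x)"
      by (rule less.hyps) (use Y fin finY hall in \<open>auto intro: psubset_card_mono\<close>)
    then obtain f where f: "inj_on f Y" "\<And>x. x \<in> Y \<Longrightarrow> f x \<in> N x" by blast
    define N' where "N' x = N x - \<Union>(N ` Y)" for x
    have "\<exists>\<phi>. inj_on \<phi> (X - Y) \<and> (\<forall>x\<in>X - Y. \<phi> x \<in> N' x)"
    proof (rule less.hyps)
      show "card (X - Y) < card X"
        using Y fin(1) by (intro psubset_card_mono) auto
      show "finite (X - Y)" using fin by simp
      show "finite (N' x)" if "x \<in> X - Y" for x using that fin by (simp add: N'_def)
      show "card Z \<le> card (\<Union>(N' ` Z))" if Z: "Z \<subseteq> X - Y" for Z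
      proof -
        have finZ: "finite Z" using Z fin(1) by (meson finite_Diff finite_subset)
        have "card Z + card Y = card (Z \<union> Y)"
          using Z finY finZ by (subst card_Un_disjoint) auto
        also have "\<dots> \<le> card (\<Union>(N ` (Z \<union> Y)))" by (rule hall) (use Z Y in auto)
        also have "\<Union>(N ` (Z \<union> Y)) = \<Union>(N' ` Z) \<union> \<Union>(N ` Y)" by (auto simp: N'_def)
        also have "card \<dots> \<le> card (\<Union>(N' ` Z)) + card (\<Union>(N ` Y))" by (rule card_Un_le)
        finally show ?thesis using Y(3) by linarith
      qed
    qed
    then obtain g where g: "inj_on g (X - Y)" "\<And>x. x \<in> X - Y \<Longrightarrow> g x \<in> N' x" by blast
    let ?h = "\<lambda>x. if x \<in> Y then f x else g x"
    have "inj_on ?h X"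
    proof (rule inj_onI)
      fix x y assume xy: "x \<in> X" "y \<in> X" "?h x = ?h y"
      have "f u \<noteq> g v" if "u \<in> Y" "v \<in> X - Y" for u v
        using f(2)[of u] g(2)[of v] that unfolding N'_def by auto
      with xy show "x = y"
        using inj_onD[OF f(1)] inj_onD[OF g(1)] by (metis DiffI)
    qed
    moreover have "\<forall>x\<in>X. ?h x \<in> N x" using f(2) g(2) by (auto simp: N'_def)
    ultimately show ?thesis by blast
  next
    case False
    show ?thesis
    proof (cases "X = {}")
      case True
      then show ?thesis by simp
    next
      case False
      then obtain x where x: "x \<in> X" by blast
      have "card {x} \<le> card (\<Union>(N ` {x}))" by (rule hall) (use x in auto)
      then obtain j where j: "j \<in> N x" by fastforce
      define N' where "N' y = N y - {j}" for y
      have "\<exists>\<phi>. inj_on \<phi> (X - {x}) \<and> (\<forall>y\<in>X - {x}. \<phi> y \<in> N' y)"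
      proof (rule less.hyps)
        show "card (X - {x}) < card X" using fin(1) x by (rule card_Diff1_less)
        show "finite (X - {x})" using fin by simp
        show "finite (N' y)" if "y \<in> X - {x}" for y using that fin by (simp add: N'_def)
        show "card Z \<le> card (\<Union>(N' ` Z))" if Z: "Z \<subseteq> X - {x}" for Z
        proof (cases "Z = {}")
          case False
          have "card Z < card (\<Union>(N ` Z))"
            using Z False \<open>\<not> (\<exists>Y. _ Y)\<close> x by (metis Diff_iff insertCI not_le psubsetI subset_iff)
          moreover have "\<Union>(N' ` Z) = \<Union>(N ` Z) - {j}" by (auto simp: N'_def)
          ultimately show ?thesis by (simp add: card_Diff_singleton_if) linarith
        qed simp
      qed
      then obtain g where g: "inj_on g (X - {x})" "\<And>y. y \<in> X - {x} \<Longrightarrow> g y \<in> N' y" by blast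
      have "inj_on (g(x := j)) X" 
        using g x unfolding inj_on_def N'_def by (metis DiffE DiffI fun_upd_apply singletonD singletonI)
      moreover have "\<forall>y\<in>X. (g(x := j)) y \<in> N y" using g(2) j by (auto simp: N'_def)
      ultimately show ?thesis by blast
    qed
  qed
qed

section \<open>Paving matroids\<close>

text \<open>Repeated exchange with elements of \<open>J\<close>.\<close>

lemma matroid_extend:
  assumes "is_matroid M" "I \<in> indeps M" "J \<in> indeps M" "card I \<le> card J"
  shows "\<exists>B \<in> indeps M. I \<subseteq> B \<and> card B = card J"
  using assms(2,4)
proof (induction "card J - card I" arbitrary: I)
  case 0
  then show ?case by auto
next
  case (Suc k)
  then have "card I < card J" by simp
  moreover have "\<forall>I J. I \<in> indeps M \<longrightarrow> J \<in> indeps M \<longrightarrow> card I < card J \<longrightarrow>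
      (\<exists>x \<in> J - I. insert x I \<in> indeps M)"
    using assms(1) by (simp add: is_matroid_def)
  ultimately obtain x where x: "x \<in> J - I" "insert x I \<in> indeps M"
    using assms(3) Suc.prems(1) by meson
  have "finite (ground M)" "indeps M \<subseteq> Pow (ground M)"
    using assms(1) by (simp_all add: is_matroid_def)
  then have "finite I" using Suc.prems(1) finite_subset by blast
  then have "card (insert x I) = Suc (card I)" using x by simp
  then have "k = card J - card (insert x I)" "card (insert x I) \<le> card J"
    using Suc.hyps(2) \<open>card I < card J\<close> by auto
  from Suc.hyps(1)[OF this(1) x(2) this(2)] show ?case by blast
qed

definition paving_matroid :: "'a set \<Rightarrow> nat \<Rightarrow> 'a set set \<Rightarrow> 'a matroid" where
  "paving_matroid E n \<H> =
     \<lparr>ground = E, indeps = {I. I \<subseteq> E \<and> card I \<le> n \<and> (card I = n \<longrightarrow> (\<forall>H\<in>\<H>. \<not> I \<subseteq> H))}\<rparr>"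

lemma indeps_paving:
  "I \<in> indeps (paving_matroid E n \<H>) \<longleftrightarrow>
    I \<subseteq> E \<and> card I \<le> n \<and> (card I = n \<longrightarrow> (\<forall>H\<in>\<H>. \<not> I \<subseteq> H))"
  by (simp add: paving_matroid_def)

locale paving =
  fixes E :: "'a set" and n :: nat and \<H> :: "'a set set"
  assumes finite_ground: "finite E"
    and n_pos: "0 < n"
    and hyperplanes_meet: "\<And>H H'. H \<in> \<H> \<Longrightarrow> H' \<in> \<H> \<Longrightarrow> H \<noteq> H' \<Longrightarrow> card (H \<inter> H' \<inter> E) + 2 \<le> n"
begin

text \<open>A set of \<open>n - 1\<close> elements spans at most one hyperplane, since two of them share at most
  \<open>n - 2\<close> elements.\<close>

lemma hyperplane_unique:
  assumes "H \<in> \<H>" "H' \<in> \<H>" "X \<subseteq> E" "X \<subseteq> H" "X \<subseteq> H'" "n \<le> Suc (card X)"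
  shows "H = H'"
proof (rule ccontr)
  assume "H \<noteq> H'"
  then have "card (H \<inter> H' \<inter> E) + 2 \<le> n" using hyperplanes_meet assms by blast
  moreover have "card X \<le> card (H \<inter> H' \<inter> E)"
    by (rule card_mono) (use finite_ground assms in auto)
  ultimately show False using assms by linarith
qed

text \<open>If adding any element of \<open>J\<close> to \<open>I\<close> ended in a hyperplane, all these hyperplanes would contain
  \<open>I\<close>, hence coincide, and their common value would contain \<open>J\<close>.\<close>

lemma augment:
  assumes "I \<subseteq> E" "J \<subseteq> E" "Suc (card I) = n" "n \<le> card J" "\<forall>H\<in>\<H>. \<not> J \<subseteq> H"
  shows "\<exists>x \<in> J - I. \<forall>H\<in>\<H>. \<not> insert x I \<subseteq> H"
proof (rule ccontr)
  assume a: "\<not> ?thesis"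
  have "finite I" "finite J" using assms finite_ground finite_subset by blast+
  then have "\<not> J \<subseteq> I" using card_mono[of I J] assms by auto
  then obtain x where x: "x \<in> J - I" by blast
  then obtain H where H: "H \<in> \<H>" "insert x I \<subseteq> H" using a by blast
  have "J \<subseteq> H"
  proof
    fix y assume y: "y \<in> J"
    show "y \<in> H"
    proof (cases "y \<in> I")
      case True
      then show ?thesis using H by blast
    next
      case False
      then obtain H' where H': "H' \<in> \<H>" "insert y I \<subseteq> H'" using a y by blast
      have "H = H'" by (rule hyperplane_unique[of _ _ I]) (use H H' assms in auto)
      then show ?thesis using H' by blast
    qed
  qed
  then show False using assms H by blast
qed

lemma is_matroid_paving: "is_matroid (paving_matroid E n \<H>)"
proof -
  have fin: "finite I" if "I \<subseteq> E" for I using finite_ground finite_subset that by blast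
  have aug: "\<exists>x \<in> J - I. insert x I \<in> indeps (paving_matroid E n \<H>)"
    if I: "I \<in> indeps (paving_matroid E n \<H>)" and J: "J \<in> indeps (paving_matroid E n \<H>)"
      and IJ: "card I < card J" for I J
  proof -
    have s: "I \<subseteq> E" "J \<subseteq> E" "card J \<le> n" and g: "card J = n \<Longrightarrow> \<forall>H\<in>\<H>. \<not> J \<subseteq> H"
      using I J by (auto simp: paving_matroid_def)
    show ?thesis
    proof (cases "Suc (card I) = n")
      case True
      then obtain x where "x \<in> J - I" "\<forall>H\<in>\<H>. \<not> insert x I \<subseteq> H"
        using augment[of I J] s g IJ by auto
      then show ?thesis using s True by (intro bexI[of _ x]) (auto simp: paving_matroid_def fin)
    next
      case False
      have "\<not> J \<subseteq> I" using card_mono[of I J] fin s IJ by auto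
      then obtain x where "x \<in> J - I" by blast
      then show ?thesis using s False IJ
        by (intro bexI[of _ x]) (auto simp: paving_matroid_def fin)
    qed
  qed
  have sub: "J \<in> indeps (paving_matroid E n \<H>)"
    if I: "I \<in> indeps (paving_matroid E n \<H>)" and J: "J \<subseteq> I" for I J
  proof -
    have s: "I \<subseteq> E" "finite I" using I fin by (auto simp: paving_matroid_def)
    then have "card J \<le> card I" "card J = card I \<Longrightarrow> J = I"
      using J by (auto intro: card_mono dest: card_subset_eq)
    then show ?thesis using I J by (auto simp: paving_matroid_def)
  qed
  have "finite (ground (paving_matroid E n \<H>))"
    "indeps (paving_matroid E n \<H>) \<subseteq> Pow (ground (paving_matroid E n \<H>))"
    "{} \<in> indeps (paving_matroid E n \<H>)"
    using finite_ground n_pos by (auto simp: paving_matroid_def)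
  then show ?thesis unfolding is_matroid_def using aug sub by blast
qed

text \<open>The rank function, made total by ignoring elements outside \<open>E\<close>, so that the submodular calculus
  applies without side conditions.\<close>

definition rk :: "'a set \<Rightarrow> int" where
  "rk X = (if card (X \<inter> E) < n then int (card (X \<inter> E))
           else if \<exists>H\<in>\<H>. X \<inter> E \<subseteq> H then int n - 1 else int n)"

lemma rank_paving:
  assumes "X \<subseteq> E"
  shows "int (rank (paving_matroid E n \<H>) X) = rk X"
proof -
  let ?M = "paving_matroid E n \<H>"
  let ?S = "{card I | I. I \<in> indeps ?M \<and> I \<subseteq> X}"
  have finX: "finite X" using assms finite_ground finite_subset by blast
  have [simp]: "X \<inter> E = X" using assms by blast
  have eq: "rank ?M X = k" if "\<And>I. I \<in> indeps ?M \<Longrightarrow> I \<subseteq> X \<Longrightarrow> card I \<le> k"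
    and "\<exists>I \<in> indeps ?M. I \<subseteq> X \<and> card I = k" for k
    unfolding rank_def
  proof (rule Max_eqI)
    have "?S \<subseteq> card ` Pow X" by auto
    then show "finite ?S" using finX finite_subset by blast
  qed (use that in auto)
  consider "card X < n" | "n \<le> card X" "\<exists>H\<in>\<H>. X \<subseteq> H" | "n \<le> card X" "\<forall>H\<in>\<H>. \<not> X \<subseteq> H"
    by (meson not_le)
  then show ?thesis
  proof cases
    case 1
    have "rank ?M X = card X"
    proof (rule eq)
      show "card I \<le> card X" if "I \<subseteq> X" for I using that finX by (simp add: card_mono)
      show "\<exists>I \<in> indeps ?M. I \<subseteq> X \<and> card I = card X"
        using 1 assms by (intro bexI[of _ X]) (auto simp: paving_matroid_def)
    qed
    then show ?thesis using 1 by (simp add: rk_def)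
  next
    case 2
    then have "n - 1 \<le> card X" by simp
    then obtain I where I: "I \<subseteq> X" "card I = n - 1" by (metis obtain_subset_with_card_n)
    have "rank ?M X = n - 1"
    proof (rule eq)
      show "card J \<le> n - 1" if "J \<in> indeps ?M" "J \<subseteq> X" for J
      proof -
        obtain H where "H \<in> \<H>" "X \<subseteq> H" using 2 by blast
        then have "card J \<noteq> n" "card J \<le> n"
          using that unfolding indeps_paving by blast+
        then show ?thesis by linarith
      qed
      show "\<exists>I \<in> indeps ?M. I \<subseteq> X \<and> card I = n - 1"
        using I assms n_pos by (intro bexI[of _ I]) (auto simp: paving_matroid_def)
    qed
    then show ?thesis using 2 n_pos by (simp add: rk_def of_nat_diff)
  next
    case 3
    then have "n - 1 \<le> card X" by simp
    then obtain I where I: "I \<subseteq> X" "card I = n - 1" by (metis obtain_subset_with_card_n)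
    have "\<exists>x \<in> X - I. \<forall>H\<in>\<H>. \<not> insert x I \<subseteq> H"
      by (rule augment) (use I assms 3 n_pos in auto)
    then obtain x where x: "x \<in> X - I" "\<forall>H\<in>\<H>. \<not> insert x I \<subseteq> H" by blast
    have "card (insert x I) = n"
      using x I n_pos finX by (simp add: finite_subset)
    have "rank ?M X = n"
    proof (rule eq)
      show "card J \<le> n" if "J \<in> indeps ?M" for J using that by (simp add: paving_matroid_def)
      show "\<exists>J \<in> indeps ?M. J \<subseteq> X \<and> card J = n"
        using x I assms \<open>card (insert x I) = n\<close>
        by (intro bexI[of _ "insert x I"]) (auto simp: paving_matroid_def)
    qed
    then show ?thesis using 3 by (simp add: rk_def)
  qed
qed

lemma rk_le: "rk X \<le> int n" "rk X \<le> int (card (X \<inter> E))"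
  by (auto simp: rk_def)

lemma rk_mono:
  assumes "X \<subseteq> Y"
  shows "rk X \<le> rk Y"
proof -
  have "card (X \<inter> E) \<le> card (Y \<inter> E)"
    by (rule card_mono) (use assms finite_ground in auto)
  moreover have "(\<exists>H\<in>\<H>. Y \<inter> E \<subseteq> H) \<longrightarrow> (\<exists>H\<in>\<H>. X \<inter> E \<subseteq> H)" using assms by blast
  ultimately show ?thesis unfolding rk_def by simp
qed

text \<open>When one of the sets has fewer than \<open>n\<close> elements its rank is its cardinality, and the
  other rank drops below the maximum by at most one. Two large sets of rank \<open>n - 1\<close> either share
  a hyperplane or meet in at most \<open>n - 2\<close> elements.\<close>

lemma rk_submodular: "rk (X \<union> Y) + rk (X \<inter> Y) \<le> rk X + rk Y"
proof -
  have fin: "finite (X \<inter> E)" for X using finite_ground by auto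
  have small: "rk (X \<union> Y) + rk (X \<inter> Y) \<le> rk X + rk Y" if X: "card (X \<inter> E) < n" for X Y
  proof -
    have c: "card ((X \<union> Y) \<inter> E) + card (X \<inter> Y \<inter> E) = card (X \<inter> E) + card (Y \<inter> E)"
    proof -
      have "(X \<union> Y) \<inter> E = X \<inter> E \<union> Y \<inter> E" "X \<inter> Y \<inter> E = X \<inter> E \<inter> (Y \<inter> E)" by blast+
      then show ?thesis using card_Un_Int[OF fin fin, of X Y] by presburger
    qed
    have rX: "rk X = int (card (X \<inter> E))" using X by (simp add: rk_def)
    show ?thesis
    proof (cases "card (Y \<inter> E) < n")
      case True
      then have "rk Y = int (card (Y \<inter> E))" by (simp add: rk_def)
      then show ?thesis using rX c rk_le(2)[of "X \<union> Y"] rk_le(2)[of "X \<inter> Y"] by linarith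
    next
      case False
      then have Y: "rk Y \<ge> int n - 1" by (auto simp: rk_def)
      show ?thesis
      proof (cases "X \<inter> E \<subseteq> Y")
        case True
        then have "(X \<union> Y) \<inter> E = Y \<inter> E" by blast
        then have "rk (X \<union> Y) = rk Y" by (simp add: rk_def)
        then show ?thesis using rk_mono[of "X \<inter> Y" X] by simp
      next
        case F: False
        have "card (X \<inter> Y \<inter> E) < card (X \<inter> E)"
          by (rule psubset_card_mono) (use F finite_ground in auto)
        then show ?thesis using rX Y rk_le(1)[of "X \<union> Y"] rk_le(2)[of "X \<inter> Y"] by linarith
      qed
    qed
  qed
  have hyp: "\<exists>H\<in>\<H>. X \<inter> E \<subseteq> H \<and> rk X = int n - 1" if "n \<le> card (X \<inter> E)" "rk X \<noteq> int n" for X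
    using that by (auto simp: rk_def split: if_splits)
  then consider "card (X \<inter> E) < n" | "card (Y \<inter> E) < n" | "rk X = int n" | "rk Y = int n"
    | H H' where "H \<in> \<H>" "H' \<in> \<H>" "X \<inter> E \<subseteq> H" "Y \<inter> E \<subseteq> H'" "rk X = int n - 1" "rk Y = int n - 1"
    by (meson not_le)
  then show ?thesis
  proof cases
    case 1
    then show ?thesis by (rule small)
  next
    case 2
    then show ?thesis using small[of Y X] by (simp add: Un_ac Int_ac)
  next
    case 3
    then show ?thesis using rk_le(1)[of "X \<union> Y"] rk_mono[of "X \<inter> Y" Y] by simp
  next
    case 4
    then show ?thesis using rk_le(1)[of "X \<union> Y"] rk_mono[of "X \<inter> Y" X] by simp
  next
    case 5
    show ?thesis
    proof (cases "H = H'")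
      case True
      then have "(X \<union> Y) \<inter> E \<subseteq> H" using 5 by blast
      then have "rk (X \<union> Y) \<le> int n - 1" using 5(1) unfolding rk_def by auto
      then show ?thesis using rk_mono[of "X \<inter> Y" X] 5 by simp
    next
      case False
      then have "card (H \<inter> H' \<inter> E) + 2 \<le> n" using hyperplanes_meet 5 by blast
      moreover have "card (X \<inter> Y \<inter> E) \<le> card (H \<inter> H' \<inter> E)"
        by (rule card_mono) (use finite_ground 5 in auto)
      ultimately have "rk (X \<inter> Y) \<le> int n - 2" using rk_le(2)[of "X \<inter> Y"] by linarith
      then show ?thesis using rk_le(1)[of "X \<union> Y"] 5 by linarith
    qed
  qed
qed

sublocale submodular_rank rk
proof
  fix W X Y Z :: "'a set"
  assume "Z \<subseteq> X" "Z \<subseteq> Y" "W \<subseteq> X \<union> Y"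
  then have "rk Z \<le> rk (X \<inter> Y)" "rk W \<le> rk (X \<union> Y)" by (auto intro: rk_mono)
  then show "rk W + rk Z \<le> rk X + rk Y" using rk_submodular[of X Y] by linarith
qed

end

section \<open>The blocks of a Kinser matroid and the wheel\<close>

text \<open>Adjacency in the cycle \<open>1, 3, 4, \<dots>, n\<close>.\<close>

definition rim_adj :: "nat \<Rightarrow> nat \<Rightarrow> nat \<Rightarrow> bool" where
  "rim_adj n c d \<longleftrightarrow> c = 1 \<and> (d = 3 \<or> d = n) \<or> d = 1 \<and> (c = 3 \<or> c = n)
     \<or> c \<in> {3..n} \<and> d \<in> {3..n} \<and> (d = Suc c \<or> c = Suc d)"

text \<open>The hub \<open>2\<close> is joined to every rim vertex except \<open>1\<close>.\<close>

definition wheel_adj :: "nat \<Rightarrow> nat \<Rightarrow> nat \<Rightarrow> bool" where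
  "wheel_adj n c d \<longleftrightarrow> rim_adj n c d \<or> c = 2 \<and> d \<in> {3..n} \<or> d = 2 \<and> c \<in> {3..n}"

locale kinser_configuration =
  fixes n :: nat and V :: "nat \<Rightarrow> 'a set"
  assumes n5: "5 \<le> n" and blocks: "kinser_blocks n V"
begin

abbreviation E :: "'a set" where "E \<equiv> kin_ground n V"

definition hyperplanes :: "'a set set" where
  "hyperplanes = {V c \<union> V d | c d. wheel_adj n c d}"

lemma finite_block: "c \<in> {1..n} \<Longrightarrow> finite (V c)"
  using blocks by (simp add: kinser_blocks_def)

lemma card_block_2: "card (V 2) = 2"
  using blocks by (simp add: kinser_blocks_def)

lemma card_block: "c \<in> {1..n} \<Longrightarrow> c \<noteq> 2 \<Longrightarrow> card (V c) = n - 2"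
  using blocks unfolding kinser_blocks_def by blast

lemma card_block_le: "c \<in> {1..n} \<Longrightarrow> card (V c) \<le> n - 2"
proof (cases "c = 2")
  case True
  then show ?thesis using card_block_2 n5 by simp
next
  case False
  assume "c \<in> {1..n}"
  from card_block[OF this False] show ?thesis by simp
qed

lemma block_nonempty: "c \<in> {1..n} \<Longrightarrow> V c \<noteq> {}"
proof
  assume c: "c \<in> {1..n}" and e: "V c = {}"
  show False
  proof (cases "c = 2")
    case True
    then show ?thesis using card_block_2 e by simp
  next
    case False
    from card_block[OF c False] show ?thesis using e n5 by simp
  qed
qed

lemma block_unique: "x \<in> V c \<Longrightarrow> x \<in> V d \<Longrightarrow> c \<in> {1..n} \<Longrightarrow> d \<in> {1..n} \<Longrightarrow> c = d"
proof (rule ccontr)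
  assume a: "x \<in> V c" "x \<in> V d" "c \<in> {1..n}" "d \<in> {1..n}" "c \<noteq> d"
  have "\<forall>i \<in> {1..n}. \<forall>j \<in> {1..n}. i \<noteq> j \<longrightarrow> V i \<inter> V j = {}"
    using blocks unfolding kinser_blocks_def by (elim conjE)
  then have "V c \<inter> V d = {}" using a(3-5) by blast
  then show False using a(1,2) by blast
qed

lemma block_subset: "c \<in> {1..n} \<Longrightarrow> V c \<subseteq> E"
  by (auto simp: kin_ground_def)

lemma finite_E: "finite E"
  unfolding kin_ground_def by (intro finite_UN_I finite_block) simp_all

lemma finite_sub: "X \<subseteq> E \<Longrightarrow> finite X"
  using finite_E finite_subset by blast

lemma adj_range:
  assumes "wheel_adj n c d"
  shows "c \<in> {1..n}" "d \<in> {1..n}" "c \<noteq> d" "\<not> (c = 2 \<and> d = 1)" "\<not> (c = 1 \<and> d = 2)"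
  using assms n5 by (auto simp: wheel_adj_def rim_adj_def)

lemma adj_sym: "wheel_adj n c d \<Longrightarrow> wheel_adj n d c"
  unfolding wheel_adj_def rim_adj_def by blast

text \<open>The rim is a cycle of length \<open>n - 1 \<ge> 4\<close>, so it contains no triangle.\<close>

lemma triangle_hub:
  assumes "wheel_adj n c d" "wheel_adj n c d'" "wheel_adj n d d'"
  shows "c = 2 \<or> d = 2 \<or> d' = 2"
proof (rule ccontr)
  assume "\<not> ?thesis"
  then have "rim_adj n c d" "rim_adj n c d'" "rim_adj n d d'"
    using assms unfolding wheel_adj_def by blast+
  then show False
    unfolding rim_adj_def atLeastAtMost_iff using n5 by (elim disjE conjE; linarith)
qed

text \<open>Two different pairs of indices have at most one index in common.\<close>

lemma blocks_meet:
  assumes "c \<in> {1..n}" "d \<in> {1..n}" "c' \<in> {1..n}" "d' \<in> {1..n}"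
    and "V c \<union> V d \<noteq> V c' \<union> V d'"
  shows "\<exists>i \<in> {1..n}. (V c \<union> V d) \<inter> (V c' \<union> V d') \<subseteq> V i"
proof (cases "c = c' \<or> c = d'")
  case True
  then have "d = c \<or> \<not> (d = c' \<or> d = d')" using assms(5) by auto
  then have "(V c \<union> V d) \<inter> (V c' \<union> V d') \<subseteq> V c"
    using assms(1-4) block_unique by blast
  then show ?thesis using assms by blast
next
  case False
  then have "(V c \<union> V d) \<inter> (V c' \<union> V d') \<subseteq> V d"
    using assms(1-4) block_unique by blast
  then show ?thesis using assms by blast
qed

lemma blocks_meet_card:
  assumes "c \<in> {1..n}" "d \<in> {1..n}" "c' \<in> {1..n}" "d' \<in> {1..n}"
    and "V c \<union> V d \<noteq> V c' \<union> V d'"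
  shows "card ((V c \<union> V d) \<inter> (V c' \<union> V d') \<inter> E) + 2 \<le> n"
proof -
  obtain i where i: "i \<in> {1..n}" "(V c \<union> V d) \<inter> (V c' \<union> V d') \<subseteq> V i"
    using blocks_meet[OF assms] by blast
  then have "card ((V c \<union> V d) \<inter> (V c' \<union> V d') \<inter> E) \<le> card (V i)"
    by (intro card_mono) (auto simp: finite_block)
  then show ?thesis using card_block_le[OF i(1)] n5 by linarith
qed

lemma paving_wheel: "paving E n hyperplanes"
proof
  fix H H' assume a: "H \<in> hyperplanes" "H' \<in> hyperplanes" "H \<noteq> H'"
  then obtain c d c' d' where "H = V c \<union> V d" "wheel_adj n c d" "H' = V c' \<union> V d'" "wheel_adj n c' d'"
    unfolding hyperplanes_def by blast
  then show "card (H \<inter> H' \<inter> E) + 2 \<le> n"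
    using a(3) blocks_meet_card[of c d c' d'] adj_range(1,2)[of c d] adj_range(1,2)[of c' d'] by simp
qed (use finite_E n5 in auto)

sublocale paving E n hyperplanes by (rule paving_wheel)

lemma rk_small: "X \<subseteq> E \<Longrightarrow> card X < n \<Longrightarrow> rk X = int (card X)"
  by (simp add: rk_def Int_absorb2)

lemma rk_ge: "X \<subseteq> E \<Longrightarrow> n \<le> card X \<Longrightarrow> int n - 1 \<le> rk X"
  by (simp add: rk_def Int_absorb2)

lemma card_eq_rk: "X \<subseteq> E \<Longrightarrow> rk X \<le> int n - 2 \<Longrightarrow> int (card X) = rk X"
  using rk_small[of X] rk_ge[of X] by (cases "card X < n") auto

lemma rk_hyperplane:
  assumes "X \<subseteq> E" "rk X < int n" "n \<le> card X"
  shows "\<exists>c d. wheel_adj n c d \<and> X \<subseteq> V c \<union> V d"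
proof -
  have "\<exists>H\<in>hyperplanes. X \<subseteq> H" using assms by (auto simp: rk_def Int_absorb2 split: if_splits)
  then show ?thesis unfolding hyperplanes_def by blast
qed

lemma rk_le_hyperplane: 
  assumes "wheel_adj n c d" "X \<subseteq> V c \<union> V d"
  shows "rk X \<le> int n - 1"
proof -
  have "X \<inter> E \<subseteq> V c \<union> V d" "V c \<union> V d \<in> hyperplanes" using assms by (auto simp: hyperplanes_def)
  then show ?thesis unfolding rk_def using n5 by auto
qed

lemma adj_if_meet:
  assumes "wheel_adj n a b" "X \<subseteq> V a \<union> V b" "X \<inter> V p \<noteq> {}" "X \<inter> V q \<noteq> {}"
    and "p \<in> {1..n}" "q \<in> {1..n}" "p \<noteq> q"
  shows "wheel_adj n p q \<and> V a \<union> V b = V p \<union> V q"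
proof -
  note r = adj_range(1,2)[OF assms(1)]
  obtain x y where "x \<in> V p" "x \<in> V a \<union> V b" "y \<in> V q" "y \<in> V a \<union> V b"
    using assms(2-4) by blast
  then have "p = a \<or> p = b" "q = a \<or> q = b"
    using block_unique[of x p a] block_unique[of x p b] block_unique[of y q a]
      block_unique[of y q b] r assms(5,6) by blast+
  then show ?thesis using assms(1,7) adj_sym[OF assms(1)] by (metis Un_commute)
qed

lemma rk_2: "rk (V 2) = 2"
  using rk_small[of "V 2"] block_subset[of 2] card_block_2 n5 by simp

lemma rk_block:
  assumes "d \<in> {3..n}"
  shows "rk (V d) = int n - 2"
  using rk_small[of "V d"] block_subset[of d] card_block[of d] assms n5 by (simp add: of_nat_diff)

lemma card_two_blocks:
  assumes "c \<in> {1..n}" "d \<in> {1..n}" "c \<noteq> d"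
  shows "card (V c \<union> V d) = card (V c) + card (V d)"
proof -
  have "V c \<inter> V d = {}" using block_unique[of _ c d] assms by blast
  then show ?thesis using finite_block assms(1,2) by (simp add: card_Un_disjoint)
qed

lemma two_blocks_large:
  assumes "c \<in> {1..n}" "d \<in> {1..n}" "c \<noteq> d"
  shows "n \<le> card (V c \<union> V d)"
proof -
  have "card (V c) = n - 2 \<or> card (V d) = n - 2" "2 \<le> card (V c)" "2 \<le> card (V d)"
    using card_block[OF assms(1)] card_block[OF assms(2)] card_block_2 assms(3) n5
    by (cases "c = 2"; cases "d = 2"; simp)+
  then show ?thesis using card_two_blocks[OF assms] by linarith
qed

lemma two_blocks_subset:
  assumes "c \<in> {1..n}" "d \<in> {1..n}"
  shows "V c \<union> V d \<subseteq> E"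
  using block_subset assms by simp

lemma rk_edge:
  assumes "wheel_adj n c d"
  shows "rk (V c \<union> V d) = int n - 1"
proof -
  note r = adj_range(1-3)[OF assms]
  have "int n - 1 \<le> rk (V c \<union> V d)"
    by (rule rk_ge[OF two_blocks_subset[OF r(1,2)] two_blocks_large[OF r]])
  moreover have "rk (V c \<union> V d) \<le> int n - 1" by (rule rk_le_hyperplane[OF assms]) simp
  ultimately show ?thesis by simp
qed

text \<open>A hyperplane that contains \<open>V p\<close> and meets \<open>V q\<close> can only be \<open>V p \<union> V q\<close>.\<close>

lemma rk_full:
  assumes X: "X \<subseteq> E" "V p \<subseteq> X" "X \<inter> V q \<noteq> {}" "p \<in> {1..n}" "q \<in> {1..n}" "p \<noteq> q"
    and "n \<le> card X" and no: "\<not> (wheel_adj n p q \<and> X \<subseteq> V p \<union> V q)"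
  shows "rk X = int n"
proof (rule ccontr)
  assume "\<not> ?thesis"
  then have "rk X < int n" using rk_le(1)[of X] by linarith
  then obtain a b where ab: "wheel_adj n a b" "X \<subseteq> V a \<union> V b"
    using rk_hyperplane[OF X(1)] assms(7) by blast
  have "X \<inter> V p \<noteq> {}" using X(2) block_nonempty[OF X(4)] by blast
  from adj_if_meet[OF ab this X(3) X(4-6)] show False using ab(2) no by auto
qed

lemma rk_non_edge:
  assumes "c \<in> {1..n}" "d \<in> {1..n}" "c \<noteq> d" "\<not> wheel_adj n c d"
  shows "rk (V c \<union> V d) = int n"
proof (rule rk_full[of _ c d])
  show "(V c \<union> V d) \<inter> V d \<noteq> {}" using block_nonempty[OF assms(2)] by blast
qed (use assms two_blocks_subset[OF assms(1,2)] two_blocks_large[OF assms(1-3)] in simp_all)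

lemma rk_three_blocks:
  assumes "c \<in> {1..n}" "d \<in> {1..n}" "e \<in> {1..n}" "c \<noteq> d" "c \<noteq> e" "d \<noteq> e"
  shows "rk (V c \<union> V d \<union> V e) = int n"
proof (rule rk_full[of _ c d])
  show "V c \<union> V d \<union> V e \<subseteq> E" using block_subset assms(1-3) by simp
  then have "card (V c \<union> V d) \<le> card (V c \<union> V d \<union> V e)"
    by (intro card_mono) (auto intro: finite_sub)
  then show "n \<le> card (V c \<union> V d \<union> V e)" using two_blocks_large[OF assms(1,2,4)] by linarith
  show "(V c \<union> V d \<union> V e) \<inter> V d \<noteq> {}" using block_nonempty[OF assms(2)] by blast
  obtain x where x: "x \<in> V e" using block_nonempty[OF assms(3)] by blast
  then have "x \<notin> V c \<union> V d" using block_unique[of x e c] block_unique[of x e d] assms by blast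
  then show "\<not> (wheel_adj n c d \<and> V c \<union> V d \<union> V e \<subseteq> V c \<union> V d)" using x by blast
qed (use assms in auto)

section \<open>Shortest violations of the Kinser inequality\<close>

text \<open>The position into which a shortest violation forces the sets \<open>A\<close> and \<open>x\<close>: they fill an edge
  \<open>c\<close>, \<open>d\<close> of the wheel up to rank, \<open>A\<close> sits in the block of \<open>c\<close>, and \<open>x\<close> has at least two elements
  in the block of \<open>d\<close>. The edge may be of the rim or a spoke.\<close>

definition on_edge :: "'a set \<Rightarrow> nat \<Rightarrow> 'a set \<Rightarrow> nat \<Rightarrow> bool" where
  "on_edge A c x d \<longleftrightarrow> wheel_adj n c d \<and> A \<subseteq> V c \<and> x \<subseteq> V c \<union> V d \<and> 2 \<le> card (x - V c)
     \<and> n \<le> card (A \<union> x) \<and> card x \<le> n - 2 \<and> rk (A \<union> x) = int n - 1"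

text \<open>No shorter list of members of \<open>L\<close> violates the inequality, not just no sublist; this is what
  an induction on the length provides.\<close>

definition shortest_violation :: "'a set \<Rightarrow> 'a set \<Rightarrow> 'a set list \<Rightarrow> bool" where
  "shortest_violation A C L \<longleftrightarrow> A \<subseteq> E \<and> C \<subseteq> E \<and> (\<forall>x\<in>set L. x \<subseteq> E) \<and> 2 \<le> length L \<and> slack A C L < 0 \<and>
     (\<forall>L'. L' \<noteq> [] \<longrightarrow> length L' < length L \<longrightarrow> set L' \<subseteq> set L \<longrightarrow> 0 \<le> slack A C L')"

lemma shortest_violationD:
  assumes "shortest_violation A C L" "L' \<noteq> []" "length L' < length L" "set L' \<subseteq> set L"
  shows "0 \<le> slack A C L'"
proof -
  have "\<forall>L'. L' \<noteq> [] \<longrightarrow> length L' < length L \<longrightarrow> set L' \<subseteq> set L \<longrightarrow> 0 \<le> slack A C L'"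
    using assms(1) unfolding shortest_violation_def by (elim conjE)
  then show ?thesis using assms(2-4) by blast
qed

lemma shortest_violation_neg: "shortest_violation A C L \<Longrightarrow> slack A C L < 0"
  unfolding shortest_violation_def by (elim conjE)

text \<open>Otherwise one of the two sets could be dropped.\<close>

lemma shortest_violation_pair:
  assumes "shortest_violation A C L" "L = xs @ x # y # ys"
  shows "rk (A \<union> x) < rk (A \<union> x \<union> y)" "rk (A \<union> y) < rk (A \<union> x \<union> y)"
proof -
  have "\<not> (rk (A \<union> x \<union> y) = rk (A \<union> x) \<or> rk (A \<union> x \<union> y) = rk (A \<union> y))"
  proof
    assume "rk (A \<union> x \<union> y) = rk (A \<union> x) \<or> rk (A \<union> x \<union> y) = rk (A \<union> y)"
    from slack_drop[OF this assms(2)] obtain L' where L': "L' \<noteq> []" "length L' < length L"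
      "set L' \<subseteq> set L" "slack A C L' \<le> slack A C L" by blast
    then show False
      using shortest_violationD[OF assms(1) L'(1-3)] shortest_violation_neg[OF assms(1)] by linarith
  qed
  moreover have "rk (A \<union> x) \<le> rk (A \<union> x \<union> y)" "rk (A \<union> y) \<le> rk (A \<union> x \<union> y)"
    by (auto intro: rk_mono)
  ultimately show "rk (A \<union> x) < rk (A \<union> x \<union> y)" "rk (A \<union> y) < rk (A \<union> x \<union> y)" by auto
qed

text \<open>All four facts come from excluding common parts \<open>Z\<close> of \<open>A\<close> and \<open>x\<close> in
  \<open>slack_nonneg_if_common\<close>: \<open>A \<inter> x\<close> if \<open>A \<union> x\<close> is independent, and \<open>x\<close> or \<open>A\<close> if
  the other one of the two already spans \<open>A \<union> x\<close>.\<close>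

lemma shortest_violation_elem:
  assumes irr: "shortest_violation A C L" and x: "x \<in> set L"
  shows "n \<le> card (A \<union> x)" "card A \<le> n - 2" "card x \<le> n - 2" "rk (A \<union> x) = int n - 1"
proof -
  have sub: "A \<subseteq> E" "x \<subseteq> E" using irr x by (auto simp: shortest_violation_def)
  obtain xs ys where L: "L = xs @ x # ys" using x by (meson split_list)
  have "rk (A \<union> x) < int n"
  proof (cases ys)
    case (Cons y ys')
    then show ?thesis
      using shortest_violation_pair(1)[OF irr, of xs x y ys'] L rk_le(1)[of "A \<union> x \<union> y"] by simp
  next
    case Nil
    then have "xs \<noteq> []" using irr L by (auto simp: shortest_violation_def)
    then obtain xs' y where "xs = xs' @ [y]" by (meson rev_exhaust)
    then show ?thesis using shortest_violation_pair(2)[OF irr, of xs' y x "[]"] L Nil rk_le(1)[of "A \<union> y \<union> x"]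
      by simp
  qed
  have no: "\<not> rk A + rk x \<le> rk (A \<union> x) + rk Z" if "rk (A \<union> Z) = rk A" "rk (x \<union> Z) = rk x" for Z
  proof
    assume "rk A + rk x \<le> rk (A \<union> x) + rk Z"
    from slack_nonneg_if_common[OF that this, of C xs ys] show False
      using shortest_violation_neg[OF irr] unfolding L by linarith
  qed
  \<comment> \<open>An independent \<open>A \<union> x\<close> is modular: its common part is the intersection.\<close>
  show *: "n \<le> card (A \<union> x)"
  proof (rule ccontr)
    assume a: "\<not> ?thesis"
    note fin = finite_sub[OF sub(1)] finite_sub[OF sub(2)]
    have "card A \<le> card (A \<union> x)" "card x \<le> card (A \<union> x)" "card (A \<inter> x) \<le> card (A \<union> x)"
      using fin by (auto intro: card_mono)
    then have "rk A = int (card A)" "rk x = int (card x)" "rk (A \<union> x) = int (card (A \<union> x))"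
      "rk (A \<inter> x) = int (card (A \<inter> x))"
      using sub a by (auto intro: rk_small)
    then have "rk A + rk x = rk (A \<union> x) + rk (A \<inter> x)" using card_Un_Int[OF fin] by simp
    moreover have "A \<union> A \<inter> x = A" "x \<union> A \<inter> x = x" by auto
    ultimately show False using no[of "A \<inter> x"] by simp
  qed
  show rAx: "rk (A \<union> x) = int n - 1"
    using \<open>rk (A \<union> x) < int n\<close> rk_ge[of "A \<union> x"] * sub by simp
  have "rk A \<le> int n - 2"
  proof (rule ccontr)
    assume "\<not> ?thesis"
    moreover have "rk A \<le> rk (A \<union> x)" by (rule rk_mono) auto
    ultimately have "rk (A \<union> x) = rk A" using rAx by linarith
    then show False using no[of x] by simp
  qed
  then show "card A \<le> n - 2" using card_eq_rk[of A] sub by linarith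
  have "rk x \<le> int n - 2"
  proof (rule ccontr)
    assume "\<not> ?thesis"
    moreover have "rk x \<le> rk (A \<union> x)" by (rule rk_mono) auto
    ultimately have "rk (x \<union> A) = rk x" using rAx by (simp add: Un_commute)
    then show False using no[of A] by (simp add: Un_commute)
  qed
  then show "card x \<le> n - 2" using card_eq_rk[of x] sub by linarith
qed

text \<open>The hyperplanes around \<open>A \<union> x\<close> and \<open>A \<union> y\<close> differ for the first two members
  \<open>x\<close>, \<open>y\<close> of the list, so \<open>A\<close> lies in their intersection and hence in one block \<open>V c\<close>. As \<open>A\<close> is not
  empty, every other such hyperplane also belongs to an edge at \<open>c\<close>.\<close>

lemma shortest_violation_on_edges:
  assumes irr: "shortest_violation A C L"
  shows "\<exists>c \<in> {1..n}. \<forall>x \<in> set L. \<exists>d. on_edge A c x d"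
proof -
  have sub: "A \<subseteq> E" "\<And>x. x \<in> set L \<Longrightarrow> x \<subseteq> E" using irr by (auto simp: shortest_violation_def)
  have hyp: "\<exists>c d. wheel_adj n c d \<and> A \<union> x \<subseteq> V c \<union> V d" if "x \<in> set L" for x
    by (rule rk_hyperplane) (use shortest_violation_elem[OF irr that] sub that in auto)
  obtain x y ys where L: "L = x # y # ys" using irr
    by (cases L rule: remdups_adj.cases) (auto simp: shortest_violation_def)
  obtain c d where cd: "wheel_adj n c d" "A \<union> x \<subseteq> V c \<union> V d" using hyp[of x] L by auto
  obtain c' d' where cd': "wheel_adj n c' d'" "A \<union> y \<subseteq> V c' \<union> V d'" using hyp[of y] L by auto
  have "V c \<union> V d \<noteq> V c' \<union> V d'"
  proof
    assume "V c \<union> V d = V c' \<union> V d'"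
    then have "rk (A \<union> x \<union> y) \<le> int n - 1" using cd cd' by (intro rk_le_hyperplane[of c d]) auto
    then show False using shortest_violation_pair(1)[OF irr, of "[]" x y ys] shortest_violation_elem(4)[OF irr, of x] L
      by simp
  qed
  then obtain i where i: "i \<in> {1..n}" "(V c \<union> V d) \<inter> (V c' \<union> V d') \<subseteq> V i"
    using blocks_meet[OF adj_range(1,2)[OF cd(1)] adj_range(1,2)[OF cd'(1)]] by blast
  then have Ai: "A \<subseteq> V i" using cd(2) cd'(2) by blast
  have "A \<noteq> {}"
    using shortest_violation_elem[OF irr, of x] L n5 by auto
  then obtain a where a: "a \<in> A" by blast
  have "\<exists>d. on_edge A i z d" if z: "z \<in> set L" for z
  proof -
    obtain p q where pq: "wheel_adj n p q" "A \<union> z \<subseteq> V p \<union> V q" using hyp z by blast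
    note r = adj_range(1,2)[OF pq(1)]
    have "a \<in> V i" "a \<in> V p \<or> a \<in> V q" using a Ai pq(2) by auto
    then have "i = p \<or> i = q" using block_unique[of a i p] block_unique[of a i q] i(1) r by blast
    then obtain d where d: "wheel_adj n i d" "A \<union> z \<subseteq> V i \<union> V d" 
      using pq adj_sym[OF pq(1)] by (metis Un_commute)
    have "finite (V i)" "finite z" using finite_block[OF i(1)] finite_sub[OF sub(2)[OF z]] .
    then have "card (A \<union> z) \<le> card (V i \<union> (z - V i))" by (intro card_mono) (use Ai in auto)
    also have "\<dots> \<le> card (V i) + card (z - V i)" by (rule card_Un_le)
    finally have "2 \<le> card (z - V i)"
      using card_block_le[OF i(1)] shortest_violation_elem(1)[OF irr z] n5 by linarith
    then have "on_edge A i z d" unfolding on_edge_def using d Ai shortest_violation_elem[OF irr z] by simp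
    then show ?thesis ..
  qed
  then show ?thesis using i(1) by blast
qed

lemma on_edgeD:
  assumes "on_edge A c x d"
  shows "wheel_adj n c d" "A \<subseteq> V c" "x \<subseteq> V c \<union> V d" "2 \<le> card (x - V c)"
    "n \<le> card (A \<union> x)" "card x \<le> n - 2" "rk (A \<union> x) = int n - 1"
  using assms unfolding on_edge_def by simp_all

lemma on_edge_range:
  assumes "on_edge A c x d"
  shows "c \<in> {1..n}" "d \<in> {1..n}" "c \<noteq> d"
  using adj_range(1-3)[OF on_edgeD(1)[OF assms]] by simp_all

lemma on_edge_sub:
  assumes "on_edge A c x d"
  shows "A \<subseteq> E \<and> x \<subseteq> E \<and> finite x"
proof -
  have "A \<subseteq> E" "x \<subseteq> E"
    using on_edgeD(2,3)[OF assms] block_subset[OF on_edge_range(1)[OF assms]]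
      block_subset[OF on_edge_range(2)[OF assms]] by auto
  then show ?thesis using finite_sub by blast
qed

lemma on_edge_meets:
  assumes "on_edge A c x d"
  shows "x \<inter> V d \<noteq> {}"
proof -
  have "x - V c \<noteq> {}" using on_edgeD(4)[OF assms] by (metis card.empty not_numeral_le_zero)
  then show ?thesis using on_edgeD(3)[OF assms] by blast
qed

lemma on_edge_rk:
  assumes "on_edge A c x d"
  shows "rk x = int (card x)"
  using on_edge_sub[OF assms] on_edgeD(6)[OF assms] n5 by (intro rk_small) auto

lemma on_edge_card_Un:
  assumes "on_edge A c x d" "z \<inter> V d = {}" "finite z"
  shows "card z + 2 \<le> card (x \<union> z)"
proof -
  have "(x - V c) \<inter> z = {}" using on_edgeD(3)[OF assms(1)] assms(2) by blast
  moreover have fx: "finite x" using on_edge_sub[OF assms(1)] by blast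
  ultimately have "card (x - V c) + card z = card ((x - V c) \<union> z)"
    using assms(3) by (subst card_Un_disjoint) auto
  also have "\<dots> \<le> card (x \<union> z)" using fx assms(3) by (intro card_mono) auto
  finally show ?thesis using on_edgeD(4)[OF assms(1)] by linarith
qed

lemma on_edge_disjoint:
  assumes "on_edge A c x d" "on_edge A c y d'" "d \<noteq> d'"
  shows "y \<inter> V d = {}"
proof -
  have "x \<notin> V d" if "x \<in> V c \<union> V d'" for x
    using that on_edge_range[OF assms(1)] on_edge_range(2)[OF assms(2)] assms(3) block_unique by blast
  then show ?thesis using on_edgeD(3)[OF assms(2)] by blast
qed

text \<open>The two or more elements of \<open>x\<close> in \<open>V d\<close> are not in \<open>y\<close>.\<close>

lemma on_edge_pair:
  assumes "on_edge A c x d" "on_edge A c y d'" "d \<noteq> d'"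
  shows "int (card y) + 2 \<le> rk (x \<union> y) \<or> int n - 1 \<le> rk (x \<union> y)"
proof -
  have s: "x \<union> y \<subseteq> E" "finite y" using on_edge_sub[OF assms(1)] on_edge_sub[OF assms(2)] by auto
  have "card y + 2 \<le> card (x \<union> y)"
    by (rule on_edge_card_Un[OF assms(1) on_edge_disjoint[OF assms] s(2)])
  then show ?thesis using rk_small[OF s(1)] rk_ge[OF s(1)] by linarith
qed

text \<open>A hyperplane around \<open>x \<union> y\<close> meets \<open>V d\<close> and \<open>V d'\<close>, so it is \<open>V d \<union> V d'\<close>; it does
  not meet \<open>V c\<close>, and \<open>c\<close>, \<open>d\<close>, \<open>d'\<close> form a triangle.\<close>

lemma on_edge_pair_hyperplane:
  assumes "on_edge A c x d" "on_edge A c y d'" "d \<noteq> d'"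
    and "n \<le> card (x \<union> y)" "rk (x \<union> y) < int n"
  shows "wheel_adj n d d' \<and> x \<subseteq> V d \<and> y \<subseteq> V d' \<and> (c = 2 \<or> d = 2 \<or> d' = 2)"
proof -
  have s: "x \<union> y \<subseteq> E" using on_edge_sub[OF assms(1)] on_edge_sub[OF assms(2)] by auto
  obtain p q where pq: "wheel_adj n p q" "x \<union> y \<subseteq> V p \<union> V q"
    using rk_hyperplane[OF s assms(5,4)] by blast
  have a: "wheel_adj n c d" "wheel_adj n c d'" "x \<subseteq> V c \<union> V d" "y \<subseteq> V c \<union> V d'"
    using on_edgeD[OF assms(1)] on_edgeD[OF assms(2)] by auto
  note r = adj_range(1-3)[OF a(1)] adj_range(2,3)[OF a(2)]
  have dd: "wheel_adj n d d' \<and> V p \<union> V q = V d \<union> V d'"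
    using adj_if_meet[OF pq, of d d'] on_edge_meets[OF assms(1)] on_edge_meets[OF assms(2)] r assms(3)
    by auto
  then have "x \<subseteq> V d \<union> V d'" "y \<subseteq> V d \<union> V d'" using pq by auto
  then have "x \<subseteq> V d" "y \<subseteq> V d'"
    using a(3,4) on_edge_disjoint[OF assms(1-3)] on_edge_disjoint[OF assms(2,1) assms(3)[symmetric]]
    by blast+
  moreover have "c = 2 \<or> d = 2 \<or> d' = 2" using dd triangle_hub[OF a(1,2)] by simp
  ultimately show ?thesis using dd by simp
qed

text \<open>For \<open>n \<ge> 5\<close> the hub block is too small to contain \<open>n - 2\<close> elements.\<close>

lemma on_edge_full:
  assumes "on_edge A c x d" "x \<subseteq> V d" "card x = n - 2"
  shows "d \<noteq> 2" "x = V d"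
proof -
  note d = on_edge_range(2)[OF assms(1)]
  have "card x \<le> card (V d)" by (rule card_mono[OF finite_block[OF d] assms(2)])
  then show "d \<noteq> 2" using assms(3) card_block_2 n5 by auto
  then show "x = V d"
    using card_subset_eq[OF finite_block[OF d] assms(2)] assms(3) card_block[OF d] by simp
qed

text \<open>If \<open>d = d'\<close>, then \<open>A \<union> x \<union> y\<close> would lie in a hyperplane and
  have the same rank as \<open>A \<union> x\<close>.\<close>

lemma shortest_violation_edge_pair:
  assumes irr: "shortest_violation A C L" and L: "L = xs @ x # y # ys"
    and s: "on_edge A c x d" "on_edge A c y d'"
  shows "d \<noteq> d'" "rk (A \<union> x \<union> y) = int n"
proof -
  have rk: "int n - 1 < rk (A \<union> x \<union> y)"
    using shortest_violation_pair(1)[OF irr L] s(1) unfolding on_edge_def by simp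
  then show "rk (A \<union> x \<union> y) = int n" using rk_le(1)[of "A \<union> x \<union> y"] by linarith
  show "d \<noteq> d'"
  proof
    assume "d = d'"
    then have "rk (A \<union> x \<union> y) \<le> int n - 1"
      by (intro rk_le_hyperplane[OF on_edgeD(1)[OF s(1)]])
        (use on_edgeD(2,3)[OF s(1)] on_edgeD(3)[OF s(2)] in auto)
    then show False using rk by simp
  qed
qed

text \<open>For two sets the slack is symmetric in \<open>A\<close> and \<open>C\<close> (this is the Ingleton
  inequality), so all the restrictions on \<open>A\<close> hold for \<open>C\<close> as well. The count then forces
  \<open>x\<close> and \<open>y\<close> to be whole blocks, so both \<open>A\<close> and \<open>C\<close> lie in \<open>V 2\<close>, while \<open>A \<union> C\<close> must have rank \<open>n\<close>.\<close>

lemma shortest_violation_length: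
  assumes irr: "shortest_violation A C L"
  shows "3 \<le> length L"
proof (rule ccontr)
  assume "\<not> ?thesis"
  then have "length L = 2" using irr unfolding shortest_violation_def by linarith
  then obtain x y where L: "L = [x, y]"
    by (cases L rule: remdups_adj.cases) auto
  have swap: "slack C A [x, y] = slack A C [x, y]" by (simp add: slack_def Un_ac)
  have irr': "shortest_violation C A L"
    unfolding shortest_violation_def
  proof (intro conjI allI impI)
    show "slack C A L < 0" using irr swap L by (simp add: shortest_violation_def)
    show "0 \<le> slack C A L'" if L': "L' \<noteq> []" "length L' < length L" for L'
    proof -
      obtain z where "L' = [z]" using L' L by (cases L' rule: remdups_adj.cases) auto
      then show ?thesis using slack_singleton by simp
    qed
  qed (use irr in \<open>auto simp: shortest_violation_def\<close>)
  have Lx: "L = [] @ x # y # []" using L by simp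
  have key: "\<exists>c d d'. on_edge A c x d \<and> on_edge A c y d' \<and> d \<noteq> d' \<and> rk (A \<union> x \<union> y) = int n
      \<and> (card x = n - 2 \<longrightarrow> card y = n - 2 \<longrightarrow> rk (x \<union> y) < int n \<longrightarrow> c = 2)"
    if irr: "shortest_violation A C L" for A C
  proof -
    obtain c where "\<forall>x \<in> set L. \<exists>d. on_edge A c x d" using shortest_violation_on_edges[OF irr] by blast
    then have "\<exists>d. on_edge A c x d" "\<exists>d. on_edge A c y d" using L by simp_all
    then obtain d d' where s: "on_edge A c x d" "on_edge A c y d'" by blast
    note p = shortest_violation_edge_pair[OF irr Lx s]
    have "c = 2" if c: "card x = n - 2" "card y = n - 2" and r: "rk (x \<union> y) < int n"
    proof -
      have "card y + 2 \<le> card (x \<union> y)"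
        by (rule on_edge_card_Un[OF s(1) on_edge_disjoint[OF s p(1)]]) (use on_edge_sub[OF s(2)] in blast)
      then have "n \<le> card (x \<union> y)" using c n5 by linarith
      from on_edge_pair_hyperplane[OF s p(1) this r] show ?thesis
        using on_edge_full(1)[OF s(1)] on_edge_full(1)[OF s(2)] c by simp
    qed
    then show ?thesis using s p by blast
  qed
  obtain c d d' where A: "on_edge A c x d" "on_edge A c y d'" "d \<noteq> d'" "rk (A \<union> x \<union> y) = int n"
      "card x = n - 2 \<longrightarrow> card y = n - 2 \<longrightarrow> rk (x \<union> y) < int n \<longrightarrow> c = 2"
    using key[OF irr] by blast
  obtain c' e e' where C: "on_edge C c' x e" "on_edge C c' y e'" "rk (C \<union> x \<union> y) = int n"
      "card x = n - 2 \<longrightarrow> card y = n - 2 \<longrightarrow> rk (x \<union> y) < int n \<longrightarrow> c' = 2"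
    using key[OF irr'] by blast
  have rks: "rk (A \<union> x) = int n - 1" "rk (A \<union> y) = int n - 1" "rk (C \<union> x) = int n - 1"
      "rk (C \<union> y) = int n - 1" "rk x = int (card x)" "rk y = int (card y)"
    using on_edgeD(7)[OF A(1)] on_edgeD(7)[OF A(2)] on_edgeD(7)[OF C(1)] on_edgeD(7)[OF C(2)]
      on_edge_rk[OF A(1)] on_edge_rk[OF A(2)] by simp_all
  have neg: "slack A C [x, y] < 0" using irr L by (simp add: shortest_violation_def)
  have eq: "x \<union> C = C \<union> x" "y \<union> C = C \<union> y" "x \<union> y \<union> C = C \<union> x \<union> y" by auto
  have sl: "rk (x \<union> y) + 2 * int n - 4 - int (card x) - int (card y) < rk (A \<union> C)"
    using neg rks A(4) C(3) unfolding slack_def by (simp add: eq)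
  have b: "card x \<le> n - 2" "card y \<le> n - 2" using on_edgeD(6)[OF A(1)] on_edgeD(6)[OF A(2)] .
  note p = on_edge_pair[OF A(1-3)]
  have AC: "rk (A \<union> C) \<le> int n" by (rule rk_le)
  have xy: "int n - 1 \<le> rk (x \<union> y)" using p sl b AC n5 by linarith
  have cx: "card x = n - 2" "card y = n - 2" "rk (x \<union> y) < int n" using xy sl b AC n5 by linarith+
  then have "c = 2" "c' = 2" using A(5) C(4) by auto
  then have "A \<union> C \<subseteq> V 2" using on_edgeD(2)[OF A(1)] on_edgeD(2)[OF C(1)] by simp
  then have "rk (A \<union> C) \<le> rk (V 2)" by (rule rk_mono)
  also note rk_2
  finally show False using sl xy b n5 by linarith
qed

text \<open>Dropping \<open>y\<close> must lower the slack, i.e. the inequality \<open>gain\<close>. It leaves almost no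
  freedom: \<open>x \<union> y\<close> and \<open>y \<union> z\<close> have rank exactly \<open>n - 1\<close> and \<open>y\<close> has \<open>n - 2\<close> elements. So \<open>c\<close>, \<open>d\<close>,
  \<open>d'\<close> and \<open>c\<close>, \<open>d'\<close>, \<open>d''\<close> are triangles, each of which contains the hub; were the hub not \<open>c\<close>, then \<open>x\<close> and \<open>z\<close> would both lie
  in \<open>V 2\<close>, and the rank of \<open>x \<union> z\<close> would be too small.\<close>

lemma shortest_violation_triple:
  assumes irr: "shortest_violation A C L" and L: "L = xs @ x # y # z # zs"
    and s: "on_edge A c x d" "on_edge A c y d'" "on_edge A c z d''"
  shows "c = 2" "x = V d" "y = V d'" "z = V d''" "wheel_adj n d d'" "wheel_adj n d' d''"
    "d \<noteq> 2" "d' \<noteq> 2" "d'' \<noteq> 2"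
proof -
  have L': "L = (xs @ [x]) @ y # z # zs" using L by simp
  note p = shortest_violation_edge_pair[OF irr L s(1,2)] shortest_violation_edge_pair[OF irr L' s(2,3)]
  note sub = on_edge_sub[OF s(1)] on_edge_sub[OF s(2)] on_edge_sub[OF s(3)]
  have rks: "rk (A \<union> x) = int n - 1" "rk (A \<union> y) = int n - 1" "rk y = int (card y)" "card y \<le> n - 2"
    using on_edgeD(6,7)[OF s(1)] on_edgeD(6,7)[OF s(2)] on_edge_rk[OF s(2)] by simp_all
  have gain: "rk (x \<union> y) + rk (y \<union> z) - int (card y) - int n - 1 < rk (x \<union> z) - rk (A \<union> x \<union> z)"
  proof (rule ccontr)
    assume a: "\<not> ?thesis"
    have "slack A C (xs @ x # z # zs) \<le> slack A C (xs @ x # y # z # zs)"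
      by (rule slack_drop_interior) (use a p(2,4) rks(2,3) in linarith)
    moreover have "0 \<le> slack A C (xs @ x # z # zs)"
      by (rule shortest_violationD[OF irr]) (auto simp: L)
    ultimately show False using shortest_violation_neg[OF irr] unfolding L by linarith
  qed
  have m: "rk (x \<union> z) \<le> rk (A \<union> x \<union> z)" by (rule rk_mono) auto
  have m': "int n - 1 \<le> rk (A \<union> x \<union> z)" using rk_mono[of "A \<union> x" "A \<union> x \<union> z"] rks by simp
  have yx: "int (card y) + 2 \<le> rk (x \<union> y) \<or> int n - 1 \<le> rk (x \<union> y)"
    using on_edge_pair[OF s(1,2) p(1)] .
  have yz: "int (card y) + 2 \<le> rk (y \<union> z) \<or> int n - 1 \<le> rk (y \<union> z)"
    using on_edge_pair[OF s(3,2) p(3)[symmetric]] by (simp add: Un_commute)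
  have le: "rk (x \<union> y) \<le> int n" "rk (y \<union> z) \<le> int n" by (rule rk_le)+
  \<comment> \<open>Independent pairs: the part of \<open>y\<close> in \<open>V d'\<close> is missing from \<open>x \<union> z\<close>, which
    already makes dropping \<open>y\<close> harmless.\<close>
  have indep: "\<not> (rk (x \<union> y) \<le> int n - 2 \<and> rk (y \<union> z) \<le> int n - 2)"
  proof
    assume a: "rk (x \<union> y) \<le> int n - 2 \<and> rk (y \<union> z) \<le> int n - 2"
    then have c: "rk (x \<union> y) = int (card (x \<union> y))" "rk (y \<union> z) = int (card (y \<union> z))"
      using card_eq_rk[of "x \<union> y"] card_eq_rk[of "y \<union> z"] sub by auto
    have fin: "finite x" "finite y" "finite z" using sub by auto
    have "(x \<union> z) \<inter> V d' = {}"
      using on_edge_disjoint[OF s(2,1) p(1)[symmetric]] on_edge_disjoint[OF s(2,3) p(3)] by blast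
    then have "card (x \<union> z) + 2 \<le> card (y \<union> (x \<union> z))"
      using on_edge_card_Un[OF s(2)] fin by blast
    moreover have "card (y \<union> (x \<union> z)) + card y \<le> card (x \<union> y) + card (y \<union> z)"
    proof -
      have eq: "y \<union> (x \<union> z) = x \<union> y \<union> (y \<union> z)" by auto
      have "card y \<le> card ((x \<union> y) \<inter> (y \<union> z))" using fin by (intro card_mono) auto
      then show ?thesis unfolding eq using card_Un_Int[of "x \<union> y" "y \<union> z"] fin by simp
    qed
    moreover have "rk (x \<union> z) \<le> int (card (x \<union> z))"
      using rk_le(2)[of "x \<union> z"] sub by (simp add: Int_absorb2)
    ultimately show False using gain c m' by linarith
  qed
  have F: "card y = n - 2" "rk (x \<union> y) = int n - 1" "rk (y \<union> z) = int n - 1" "rk (A \<union> x \<union> z) = rk (x \<union> z)"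
    using gain m yx yz indep le rks(4) n5 by linarith+
  have "card y + 2 \<le> card (x \<union> y)"
    by (rule on_edge_card_Un[OF s(1) on_edge_disjoint[OF s(1,2) p(1)]]) (use sub in blast)
  then have "n \<le> card (x \<union> y)" using F n5 by linarith
  then have xy: "wheel_adj n d d'" "x \<subseteq> V d" "y \<subseteq> V d'" "c = 2 \<or> d = 2 \<or> d' = 2"
    using on_edge_pair_hyperplane[OF s(1,2) p(1)] F(2) by auto
  have "card y + 2 \<le> card (z \<union> y)"
    by (rule on_edge_card_Un[OF s(3) on_edge_disjoint[OF s(3,2) p(3)[symmetric]]])
      (use sub in blast)
  then have "n \<le> card (z \<union> y)" using F n5 by linarith
  then have zy: "wheel_adj n d'' d'" "z \<subseteq> V d''" "c = 2 \<or> d'' = 2 \<or> d' = 2"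
    using on_edge_pair_hyperplane[OF s(3,2) p(3)[symmetric]] F(3) by (simp_all add: Un_commute)
  show "d' \<noteq> 2" "y = V d'" using on_edge_full[OF s(2) xy(3) F(1)] by auto
  show c: "c = 2"
  proof (rule ccontr)
    assume "c \<noteq> 2"
    then have "x \<union> z \<subseteq> V 2" using xy zy \<open>d' \<noteq> 2\<close> by auto
    then have "rk (x \<union> z) \<le> rk (V 2)" by (rule rk_mono)
    also note rk_2
    finally show False using m' F(4) n5 by linarith
  qed
  have full: "card w = n - 2" if "on_edge A c w i" for w i
  proof -
    have "card (A \<union> w) \<le> card A + card w" by (rule card_Un_le)
    moreover have "card A \<le> 2"
      using card_mono[OF finite_block[of 2], of A] on_edgeD(2)[OF that] c card_block_2 n5 by simp
    ultimately show ?thesis using on_edgeD(5,6)[OF that] by linarith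
  qed
  show "x = V d" "d \<noteq> 2" using on_edge_full[OF s(1) xy(2) full[OF s(1)]] by auto
  show "z = V d''" "d'' \<noteq> 2" using on_edge_full[OF s(3) zy(2) full[OF s(3)]] by auto
  show "wheel_adj n d d'" "wheel_adj n d' d''" using xy zy adj_sym by auto
qed

section \<open>Paths on the rim\<close>

text \<open>Steps stay on the part \<open>3, \<dots>, n\<close> of the rim, that is, on the neighbours of the hub.\<close>

definition rim_step :: "'a set \<Rightarrow> 'a set \<Rightarrow> bool" where
  "rim_step x y \<longleftrightarrow>
     (\<exists>d\<in>{3..n}. \<exists>d'\<in>{3..n}. x = V d \<and> y = V d' \<and> (d' = Suc d \<or> d = Suc d'))"

definition rim_path :: "'a set list \<Rightarrow> bool" where
  "rim_path L \<longleftrightarrow> (\<forall>x\<in>set L. \<exists>d\<in>{3..n}. x = V d) \<and> successively rim_step L"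

lemma block_inj: "V c = V d \<Longrightarrow> c \<in> {1..n} \<Longrightarrow> d \<in> {1..n} \<Longrightarrow> c = d"
  using block_nonempty[of c] block_unique[of _ c d] by blast

text \<open>Each node contributes \<open>(n - 1) - (n - 2) = 1\<close> and each step \<open>(n - 1) - n = -1\<close>.\<close>

lemma fan_rim_path:
  assumes "rim_path L" "L \<noteq> []"
  shows "fan (V 2) L = 1"
  using assms
proof (induction L rule: remdups_adj.induct)
  case (2 x)
  then obtain d where d: "d \<in> {3..n}" "x = V d" unfolding rim_path_def by auto
  then have "wheel_adj n 2 d" by (simp add: wheel_adj_def)
  then show ?case using rk_edge[of 2 d] rk_block[OF d(1)] d(2) by simp
next
  case (3 x y L)
  have p: "rim_path (y # L)" using 3(3) unfolding rim_path_def by simp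
  have "rim_step x y" using 3(3) unfolding rim_path_def by simp
  then obtain d d' where d: "d \<in> {3..n}" "d' \<in> {3..n}" "x = V d" "y = V d'" "d' = Suc d \<or> d = Suc d'"
    unfolding rim_step_def by blast
  have adj: "wheel_adj n 2 d" "wheel_adj n d d'"
    using d(1,2,5) by (auto simp: wheel_adj_def rim_adj_def)
  have "rk (V 2 \<union> V d \<union> V d') = int n"
    by (rule rk_three_blocks) (use d(1,2,5) in auto)
  moreover have "fan (V 2) (y # L) = 1" 
    using 3(1,2) p by (cases "x = y") simp_all
  ultimately show ?case
    using rk_edge[OF adj(1)] rk_edge[OF adj(2)] rk_block[OF d(1)] d(3,4) by simp
qed simp

lemma rim_path_ends:
  assumes "rim_path L" "L \<noteq> []"
  shows "\<exists>p\<in>{3..n}. \<exists>q\<in>{3..n}. hd L = V p \<and> last L = V q \<and> p < q + length L \<and> q < p + length L"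
  using assms
proof (induction L rule: induct_list012)
  case (2 x)
  then show ?case unfolding rim_path_def by auto
next
  case (3 x y L)
  have p: "rim_path (y # L)" using 3(3) unfolding rim_path_def by simp
  have "rim_step x y" using 3(3) unfolding rim_path_def by simp
  then obtain d d' where d: "d \<in> {3..n}" "d' \<in> {3..n}" "x = V d" "y = V d'" "d' = Suc d \<or> d = Suc d'"
    unfolding rim_step_def by blast
  obtain p q where pq: "p \<in> {3..n}" "q \<in> {3..n}" "y = V p" "last (y # L) = V q"
      "p < q + length (y # L)" "q < p + length (y # L)"
    using 3(2)[OF p] by auto
  have "p = d'" by (rule block_inj) (use pq(1,3) d(2,4) in simp_all)
  then have "d < q + length (x # y # L)" "q < d + length (x # y # L)"
    using pq(5,6) d(5) by auto
  then show ?case using d(1,3) pq(2,4) by (intro bexI[of _ d] bexI[of _ q]) simp_all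
qed simp

text \<open>Since the list has at least three members, every consecutive pair is part of a
  triple, to which \<open>shortest_violation_triple\<close> applies. The size of \<open>A \<union> x\<close> leaves two elements for \<open>A\<close>,
  hence all of \<open>V 2\<close>.\<close>

lemma shortest_violation_rim_path:
  assumes irr: "shortest_violation A C L"
  shows "A = V 2" "rim_path L"
proof -
  obtain c where c: "c \<in> {1..n}" "\<forall>x \<in> set L. \<exists>d. on_edge A c x d"
    using shortest_violation_on_edges[OF irr] by blast
  have len: "3 \<le> length L" by (rule shortest_violation_length[OF irr])
  have pair: "c = 2 \<and> (\<exists>d d'. on_edge A c x d \<and> x = V d \<and> y = V d' \<and> wheel_adj n d d' \<and> d \<noteq> 2 \<and> d' \<noteq> 2
      \<and> wheel_adj n c d \<and> wheel_adj n c d')"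
    if L: "L = xs @ x # y # ys" for xs x y ys
  proof (cases ys)
    case (Cons z zs)
    have "x \<in> set L" "y \<in> set L" "z \<in> set L" using L Cons by auto
    then obtain d d' d'' where s: "on_edge A c x d" "on_edge A c y d'" "on_edge A c z d''" 
      using c(2) by meson
    note t = shortest_violation_triple[OF irr L[unfolded Cons] s]
    then show ?thesis using s on_edgeD(1)[OF s(1)] on_edgeD(1)[OF s(2)] by blast
  next
    case Nil
    then have "xs \<noteq> []" using L len by auto
    then obtain ws w where xs: "xs = ws @ [w]" by (meson rev_exhaust)
    have L': "L = ws @ w # x # y # []" using L Nil xs by simp
    have "x \<in> set L" "y \<in> set L" "w \<in> set L" using L' by auto
    then obtain d d' d'' where s: "on_edge A c w d" "on_edge A c x d'" "on_edge A c y d''" 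
      using c(2) by meson
    note t = shortest_violation_triple[OF irr L' s]
    then show ?thesis using s on_edgeD(1)[OF s(2)] on_edgeD(1)[OF s(3)] by blast
  qed
  obtain x y ys where L: "L = [] @ x # y # ys" using len by (cases L rule: remdups_adj.cases) auto
  obtain d where c2: "c = 2" and s: "on_edge A c x d" "x = V d" using pair[OF L] by blast
  have "n \<le> card A + card x" using on_edgeD(5)[OF s(1)] card_Un_le[of A x] by linarith
  then have "2 \<le> card A" using on_edgeD(6)[OF s(1)] n5 by linarith
  moreover have "A \<subseteq> V 2" using on_edgeD(2)[OF s(1)] c2 by simp
  ultimately show "A = V 2"
    using card_block_2 finite_block[of 2] n5 by (simp add: card_seteq)
  have edge: "rim_step x y" if L: "L = xs @ x # y # ys" for xs x y ys
  proof -
    obtain d d' where d: "x = V d" "y = V d'" "wheel_adj n d d'" "d \<noteq> 2" "d' \<noteq> 2"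
        "wheel_adj n 2 d" "wheel_adj n 2 d'" using pair[OF L] by blast
    have "d \<in> {3..n}" "d' \<in> {3..n}"
      using d(4-7) n5 unfolding wheel_adj_def rim_adj_def by auto
    moreover from this have "d' = Suc d \<or> d = Suc d'"
      using d(3-5) unfolding wheel_adj_def rim_adj_def by auto
    ultimately show ?thesis using d(1,2) unfolding rim_step_def by blast
  qed
  have "\<exists>d\<in>{3..n}. z = V d" if z: "z \<in> set L" for z
  proof -
    obtain xs ys where L: "L = xs @ z # ys" using z by (meson split_list)
    show ?thesis
    proof (cases ys)
      case (Cons y ys')
      then show ?thesis using edge[of xs z y ys'] L unfolding rim_step_def by blast
    next
      case Nil
      then have "xs \<noteq> []" using L len by auto
      then obtain ws w where "xs = ws @ [w]" by (meson rev_exhaust)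
      then show ?thesis using edge[of ws w z "[]"] L Nil unfolding rim_step_def by auto
    qed
  qed
  moreover have "successively rim_step L"
    unfolding successively_conv_nth
  proof (intro allI impI)
    fix i assume i: "Suc i < length L"
    have "L = take i L @ L ! i # L ! Suc i # drop (Suc (Suc i)) L"
      using i by (metis Cons_nth_drop_Suc Suc_lessD append_take_drop_id)
    then show "rim_step (L ! i) (L ! Suc i)" by (rule edge)
  qed
  ultimately show "rim_path L" unfolding rim_path_def by blast
qed

section \<open>The ends of a rim path\<close>

lemma rk_block_Un:
  assumes "p \<in> {3..n}" "C \<subseteq> E"
  shows "int n - 2 \<le> rk (V p \<union> C)" "\<not> C \<subseteq> V p \<Longrightarrow> int n - 1 \<le> rk (V p \<union> C)"
proof -
  show "int n - 2 \<le> rk (V p \<union> C)"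
    using rk_mono[of "V p" "V p \<union> C"] rk_block[OF assms(1)] by simp
  assume nC: "\<not> C \<subseteq> V p"
  have sub: "V p \<union> C \<subseteq> E" using assms block_subset[of p] by simp
  have "card (V p) < card (V p \<union> C)"
    by (rule psubset_card_mono) (use nC finite_sub[OF sub] in auto)
  then show "int n - 1 \<le> rk (V p \<union> C)"
    using rk_ge[OF sub] rk_small[OF sub] card_block[of p] assms(1) n5 by (cases "n \<le> card (V p \<union> C)") auto
qed

text \<open>Here \<open>V p \<union> C = V p\<close>, and \<open>V 2 \<union> C\<close> lies in the hyperplane of the spoke \<open>2\<close>, \<open>p\<close>.
  The remaining comparison depends on whether \<open>C\<close> has none, one or more elements.\<close>

lemma end_inequality_contained:
  assumes p: "p \<in> {3..n}" and q: "q \<in> {3..n}" and C: "C \<subseteq> V p"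
  shows "rk (V p \<union> V q \<union> C) + rk (V 2 \<union> C) \<le> rk (V p \<union> C) + rk (V q \<union> C) + 1"
proof -
  have r: "p \<in> {1..n}" "q \<in> {1..n}" "2 \<in> {1..n}" using p q n5 by auto
  have CE: "C \<subseteq> E" using C block_subset[OF r(1)] by blast
  have eq: "V p \<union> C = V p" "V p \<union> V q \<union> C = V p \<union> V q" using C by auto
  have adj2: "wheel_adj n 2 p" using p by (simp add: wheel_adj_def)
  have k: "rk (V 2 \<union> C) \<le> int n - 1" by (rule rk_le_hyperplane[OF adj2]) (use C in auto)
  have kc: "rk (V 2 \<union> C) \<le> 2 + int (card C)"
  proof -
    have s: "V 2 \<union> C \<subseteq> E" using CE block_subset[OF r(3)] by simp
    have "card (V 2 \<union> C) \<le> 2 + card C" using card_Un_le[of "V 2" C] card_block_2 by simp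
    then show ?thesis using rk_le(2)[of "V 2 \<union> C"] s by (simp add: Int_absorb2)
  qed
  note b = rk_block_Un[OF q CE]
  have goal: "rk (V p \<union> V q) + rk (V 2 \<union> C) \<le> int n - 1 + rk (V q \<union> C)"
  proof (cases "p = q")
    case True
    then show ?thesis using k b(1) rk_block[OF q] by simp
  next
    case pq: False
    have disj: "V p \<inter> V q = {}" using block_unique[of _ p q] r pq by blast
    have nC: "\<not> C \<subseteq> V q" if "C \<noteq> {}" using C disj that by blast
    have t: "rk (V p \<union> V q) \<le> int n" by (rule rk_le)
    consider "C = {}" | "card C = 1" | "2 \<le> card C" 
      using finite_sub[OF CE] by (metis One_nat_def Suc_1 Suc_leI card_0_eq le_neq_implies_less not_gr_zero)
    then show ?thesis
    proof cases
      case 1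
      then show ?thesis using t kc b(1) n5 by simp
    next
      case 2
      then have "\<not> C \<subseteq> V q" using nC by fastforce
      then show ?thesis using b(2) t kc 2 n5 by simp
    next
      case 3
      then have nC: "\<not> C \<subseteq> V q" using nC by fastforce
      show ?thesis
      proof (cases "wheel_adj n p q")
        case True
        then show ?thesis using rk_edge[OF True] k b(2)[OF nC] by linarith
      next
        case False
        have "rk (V q \<union> C) = int n"
        proof (rule rk_full[of _ q p])
          show s: "V q \<union> C \<subseteq> E" using CE block_subset[OF r(2)] by simp
          have "card (V q \<union> C) = card (V q) + card C"
            by (rule card_Un_disjoint) (use finite_block[OF r(2)] finite_sub[OF CE] C disj in auto)
          then show "n \<le> card (V q \<union> C)" using 3 card_block[OF r(2)] q by simp
          show "(V q \<union> C) \<inter> V p \<noteq> {}" using nC C by blast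
          show "\<not> (wheel_adj n q p \<and> V q \<union> C \<subseteq> V q \<union> V p)" using False adj_sym[of q p] by blast
        qed (use r pq in simp_all)
        then show ?thesis using t k by linarith
      qed
    qed
  qed
  then show ?thesis using eq rk_block[OF p] by simp
qed

lemma rk_block_Un_cases:
  assumes "p \<in> {3..n}" "C \<subseteq> E" "\<not> C \<subseteq> V p" "rk (V p \<union> C) < int n"
  shows "card (C - V p) \<le> 1 \<or> (\<exists>p'. wheel_adj n p p' \<and> C \<subseteq> V p \<union> V p')"
proof (cases "n \<le> card (V p \<union> C)")
  case False
  have r: "p \<in> {1..n}" using assms by auto
  have "card (V p \<union> C) = card (V p) + card (C - V p)"
    using card_Un_disjoint[of "V p" "C - V p"] finite_block[OF r] finite_sub[OF assms(2)] by auto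
  moreover have "card (V p) = n - 2" using card_block[OF r] assms(1) by simp
  ultimately show ?thesis using False n5 by linarith
next
  case True
  have r: "p \<in> {1..n}" using assms by auto
  have "V p \<union> C \<subseteq> E" using assms block_subset[OF r] by simp
  from rk_hyperplane[OF this assms(4) True] obtain a b where
    ab: "wheel_adj n a b" "V p \<union> C \<subseteq> V a \<union> V b" by blast
  obtain x where x: "x \<in> V p" using block_nonempty[OF r] by blast
  then have "p = a \<or> p = b"
    using ab(2) block_unique[of x p a] block_unique[of x p b] r adj_range(1,2)[OF ab(1)] by blast
  then show ?thesis using ab adj_sym[OF ab(1)] by auto
qed

text \<open>Failure would force \<open>V p \<union> C\<close> and \<open>V q \<union> C\<close> into hyperplanes, up to one element, although
  \<open>V p \<union> V q \<union> C\<close> and \<open>V 2 \<union> C\<close> have full rank. This leaves only \<open>C\<close> inside one block \<open>V w\<close> adjacent to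
  both \<open>V p\<close> and \<open>V q\<close> but not to \<open>V 2\<close>, i.e. \<open>w = 1\<close>; so \<open>p\<close> and \<open>q\<close> are the two ends \<open>3\<close> and \<open>n\<close>, and the
  assumption \<open>near\<close> excludes exactly this.\<close>

lemma end_inequality:
  assumes p: "p \<in> {3..n}" and q: "q \<in> {3..n}" and near: "p + 3 < q + n" "q + 3 < p + n"
    and C: "C \<subseteq> E"
  shows "rk (V p \<union> V q \<union> C) + rk (V 2 \<union> C) \<le> rk (V p \<union> C) + rk (V q \<union> C) + 1"
proof (cases "C \<subseteq> V p \<or> C \<subseteq> V q")
  case True
  then show ?thesis
  proof
    assume "C \<subseteq> V q"
    from end_inequality_contained[OF q p this] show ?thesis by (simp add: Un_ac)
  qed (rule end_inequality_contained[OF p q])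
next
  case False
  then have nC: "\<not> C \<subseteq> V p" "\<not> C \<subseteq> V q" by auto
  have r: "p \<in> {1..n}" "q \<in> {1..n}" "2 \<in> {1..n}" using p q n5 by auto
  show ?thesis
  proof (rule ccontr)
    assume neg: "\<not> ?thesis"
    note le = rk_le(1)[of "V p \<union> V q \<union> C"] rk_le(1)[of "V 2 \<union> C"]
    note ge = rk_block_Un(2)[OF p C nC(1)] rk_block_Un(2)[OF q C nC(2)]
    have F: "rk (V p \<union> C) < int n" "rk (V q \<union> C) < int n" "rk (V p \<union> V q \<union> C) = int n"
      "rk (V 2 \<union> C) = int n" using neg le ge by linarith+
    have pq: "p \<noteq> q" using F(1,3) by auto
    have disj: "V p \<inter> V q = {}" using block_unique[of _ p q] r pq by blast
    have finC: "finite C" by (rule finite_sub[OF C])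
    have "n \<le> card (V 2 \<union> C)" 
    proof -
      have "V 2 \<union> C \<subseteq> E" using C block_subset[OF r(3)] by simp
      then show ?thesis using rk_le(2)[of "V 2 \<union> C"] F(4) by (simp add: Int_absorb2)
    qed
    then have C3: "3 \<le> card C" using card_Un_le[of "V 2" C] card_block_2 n5 by linarith
    have no_edge: False if "wheel_adj n a b" "C \<subseteq> V a \<union> V b" "V p \<union> V q \<subseteq> V a \<union> V b" for a b
      using rk_le_hyperplane[OF that(1), of "V p \<union> V q \<union> C"] that(2,3) F(3) by simp
    \<comment> \<open>If \<open>V u \<union> C\<close> has only one element outside \<open>V u\<close>, then \<open>C\<close> meets \<open>V u\<close>, so the hyperplane
      around \<open>V v \<union> C\<close> is \<open>V u \<union> V v\<close>.\<close>
    have mixed: False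
      if u: "u \<in> {3..n}" "v \<in> {3..n}" "{u, v} = {p, q}" "card (C - V u) \<le> 1"
        "wheel_adj n v w" "C \<subseteq> V v \<union> V w" for u v w
    proof -
      have "card C \<le> card (C \<inter> V u) + card (C - V u)" 
        using card_Int_Diff[OF finC, of "V u"] by simp
      then have "C \<inter> V u \<noteq> {}" using C3 u(4) by auto
      then obtain x where x: "x \<in> C" "x \<in> V u" by blast
      have "u \<noteq> v" using u(3) pq by auto
      have uv: "u \<in> {1..n}" "v \<in> {1..n}" using u(1,2) by auto
      have "x \<in> V v \<or> x \<in> V w" using x u(6) by blast
      then have "u = w"
        using block_unique[of x u v] block_unique[of x u w] x(2) uv adj_range(2)[OF u(5)] \<open>u \<noteq> v\<close>
        by blast
      then have "V p \<union> V q \<subseteq> V v \<union> V w" using u(3) by auto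
      then show False using no_edge[OF u(5,6)] by blast
    qed
    consider (small) "card (C - V p) \<le> 1" "card (C - V q) \<le> 1"
      | (left) w where "card (C - V p) \<le> 1" "wheel_adj n q w" "C \<subseteq> V q \<union> V w"
      | (right) w where "card (C - V q) \<le> 1" "wheel_adj n p w" "C \<subseteq> V p \<union> V w"
      | (edges) w w' where "wheel_adj n p w" "C \<subseteq> V p \<union> V w" "wheel_adj n q w'" "C \<subseteq> V q \<union> V w'"
      using rk_block_Un_cases[OF p C nC(1) F(1)] rk_block_Un_cases[OF q C nC(2) F(2)] by blast
    then show False
    proof cases
      case small
      have "C = (C - V p) \<union> (C - V q)" using disj by blast
      then have "card C \<le> card (C - V p) + card (C - V q)" using card_Un_le by metis
      then show ?thesis using small C3 by linarith
    next
      case left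
      then show ?thesis using mixed[of p q w] p q by blast
    next
      case right
      then show ?thesis using mixed[of q p w] p q by (simp add: insert_commute)
    next
      case edges
      note rw = adj_range(2)[OF edges(1)] adj_range(2)[OF edges(3)]
      have w: "w \<noteq> q" using no_edge[OF edges(1,2)] by auto
      have w': "w' \<noteq> p" using no_edge[OF edges(3,4)] by auto
      obtain x where x: "x \<in> C" "x \<notin> V p" using nC by blast
      have "x \<in> V w" using x edges(2) by blast
      moreover have "x \<in> V q \<or> x \<in> V w'" using x edges(4) by blast
      ultimately have ww: "w = w'"
        using block_unique[of x w q] block_unique[of x w w'] w rw r(2) by blast
      have CV: "C \<subseteq> V w" using edges(2,4) disj ww by blast
      have "w \<noteq> 2" using CV C3 card_mono[OF finite_block[OF rw(1)] CV] card_block_2 by auto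
      show ?thesis
      proof (cases "w = 1")
        case True
        then have "p = 3 \<or> p = n" "q = 3 \<or> q = n"
          using edges(1,3) ww p q unfolding wheel_adj_def rim_adj_def by auto
        then show ?thesis using pq near n5 by auto
      next
        case False
        then have "wheel_adj n 2 w" using \<open>w \<noteq> 2\<close> rw(1) by (simp add: wheel_adj_def)
        then have "rk (V 2 \<union> C) \<le> int n - 1" by (rule rk_le_hyperplane) (use CV in auto)
        then show ?thesis using F(4) by simp
      qed
    qed
  qed
qed

text \<open>Induction on the length supplies a shortest violation, which is a rim path; with at most \<open>n - 3\<close>
  members it is too short to lead from \<open>V 3\<close> to \<open>V n\<close>.\<close>

lemma slack_nonneg:
  assumes "A \<subseteq> E" "C \<subseteq> E" "\<forall>x\<in>set L. x \<subseteq> E" "L \<noteq> []" "length L + 3 \<le> n"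
  shows "0 \<le> slack A C L"
  using assms
proof (induction "length L" arbitrary: L rule: less_induct)
  case less
  show ?case
  proof (rule ccontr)
    assume neg: "\<not> 0 \<le> slack A C L"
    have "length L \<noteq> 1"
    proof
      assume "length L = 1"
      then obtain x where "L = [x]" by (cases L rule: remdups_adj.cases) auto
      then show False using neg slack_singleton by simp
    qed
    then have "2 \<le> length L" using less.prems(4) by (cases L rule: remdups_adj.cases) auto
    moreover have "0 \<le> slack A C L'" if "L' \<noteq> []" "length L' < length L" "set L' \<subseteq> set L" for L'
      by (rule less.hyps) (use that less.prems in auto)
    ultimately have irr: "shortest_violation A C L"
      unfolding shortest_violation_def using less.prems neg by simp
    note path = shortest_violation_rim_path[OF irr]
    obtain p q where pq: "p \<in> {3..n}" "q \<in> {3..n}" "hd L = V p" "last L = V q"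
        "p < q + length L" "q < p + length L"
      using rim_path_ends[OF path(2) less.prems(4)] by blast
    have "rk (V p \<union> V q \<union> C) + rk (V 2 \<union> C) \<le> rk (V p \<union> C) + rk (V q \<union> C) + 1"
      by (rule end_inequality) (use pq less.prems in auto)
    then have "0 \<le> slack A C L"
      unfolding slack_def path(1) fan_rim_path[OF path(2) less.prems(4)] pq(3,4) by simp
    then show False using neg by simp
  qed
qed

lemma slack_blocks: "slack (V 2) (V 1) (map V [3..<Suc n]) = -1"
proof -
  have "rim_path (map V [3..<Suc n])"
    unfolding rim_path_def successively_conv_nth
  proof (intro conjI allI impI)
    fix i assume "Suc i < length (map V [3..<Suc n])"
    then have i: "3 + i < n" by (simp del: upt_Suc)
    have "map V [3..<Suc n] ! i = V (3 + i)" "map V [3..<Suc n] ! Suc i = V (Suc (3 + i))"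
      using i nth_map_upt[of i "Suc n" 3 V] nth_map_upt[of "Suc i" "Suc n" 3 V]
      by (simp_all del: upt_Suc)
    then show "rim_step (map V [3..<Suc n] ! i) (map V [3..<Suc n] ! Suc i)"
      using i unfolding rim_step_def
      by (intro bexI[of _ "3 + i"] bexI[of _ "Suc (3 + i)"]) (simp_all del: upt_Suc)
  qed auto
  then have "fan (V 2) (map V [3..<Suc n]) = 1" using fan_rim_path n5 by simp
  moreover have "hd (map V [3..<Suc n]) = V 3" "last (map V [3..<Suc n]) = V n"
    using n5 by (auto simp: hd_map last_map upt_conv_Cons)
  moreover have "rk (V 3 \<union> V 1) = int n - 1" "rk (V n \<union> V 1) = int n - 1"
    by (rule rk_edge; simp add: wheel_adj_def rim_adj_def)+
  moreover have "rk (V 3 \<union> V n \<union> V 1) = int n" by (rule rk_three_blocks) (use n5 in auto)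
  moreover have "rk (V 2 \<union> V 1) = int n"
    by (rule rk_non_edge) (use n5 in \<open>auto simp: wheel_adj_def rim_adj_def\<close>)
  ultimately show ?thesis by (simp add: slack_def)
qed

section \<open>The relaxed Kinser matroid is paving\<close>

text \<open>The presentation has one member for each rim edge, namely the complement of that edge in the rim
  blocks. It is indexed by the later end of the edge in the cyclic order \<open>1, 3, 4, \<dots>, n\<close>.\<close>

definition gaps :: "nat set" where
  "gaps = insert 1 {3..n}"

definition before :: "nat \<Rightarrow> nat" where
  "before j = (if j = 1 then n else if j = 3 then 1 else j - 1)"

definition after :: "nat \<Rightarrow> nat" where
  "after j = (if j = 1 then 3 else if j = n then 1 else Suc j)"

lemma gaps_card: "card gaps = n - 1" "finite gaps"
  using n5 by (simp_all add: gaps_def)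

lemma before_after: "i \<in> gaps \<Longrightarrow> j \<in> gaps \<Longrightarrow> before j = i \<longleftrightarrow> j = after i"
  using n5 by (auto simp: gaps_def before_def after_def)

lemma gap_range:
  assumes "j \<in> gaps"
  shows "j \<in> {0..n}" "j \<noteq> 0" "j \<noteq> 2" "before j \<in> gaps" "before j \<noteq> j" "after j \<in> gaps" "after j \<noteq> j"
    "after (after j) \<noteq> j" "j \<in> {1..n}"
  using assms n5 by (auto simp: gaps_def before_def after_def)

lemma before_adj: "j \<in> gaps \<Longrightarrow> wheel_adj n (before j) j"
  using n5 by (cases "j = 1"; cases "j = 3") (auto simp: gaps_def before_def wheel_adj_def rim_adj_def)

lemma wheel_edge_cases:
  assumes "wheel_adj n c d"
  shows "(\<exists>i \<in> gaps. V c \<union> V d = V 2 \<union> V i) \<or> (\<exists>j \<in> gaps. V c \<union> V d = V (before j) \<union> V j)"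
proof -
  have "(c = 2 \<and> d \<in> gaps) \<or> (d = 2 \<and> c \<in> gaps) \<or> (d \<in> gaps \<and> before d = c) \<or> (c \<in> gaps \<and> before c = d)"
    using assms n5 unfolding wheel_adj_def rim_adj_def
    by (elim disjE conjE) (auto simp: gaps_def before_def)
  then show ?thesis by (metis Un_commute)
qed

text \<open>The members of the presentation to which \<open>x\<close> can be assigned in a transversal.\<close>

abbreviation slots :: "'a \<Rightarrow> nat set" where
  "slots x \<equiv> {j \<in> {0..n}. x \<in> kin_presentation n V j}"

lemma presentation:
  "kin_presentation n V 0 = E" "kin_presentation n V 2 = V 2"
  "j \<in> gaps \<Longrightarrow> kin_presentation n V j = E - V 2 - (V (before j) \<union> V j)"
proof -
  show "kin_presentation n V 0 = E" "kin_presentation n V 2 = V 2"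
    by (simp_all add: kin_presentation_def Let_def)
  assume j: "j \<in> gaps"
  show "kin_presentation n V j = E - V 2 - (V (before j) \<union> V j)"
    using gap_range(2,3)[OF j] by (auto simp: kin_presentation_def Let_def before_def)
qed

lemma slots_gap:
  assumes "j \<in> gaps"
  shows "j \<in> slots x \<longleftrightarrow> x \<in> E \<and> x \<notin> V 2 \<and> x \<notin> V (before j) \<and> x \<notin> V j"
  using gap_range(1)[OF assms] presentation(3)[OF assms] by auto

lemma slots_0: "0 \<in> slots x \<longleftrightarrow> x \<in> E"
  by (simp add: presentation)

lemma slots_2: "2 \<in> slots x \<longleftrightarrow> x \<in> V 2"
  using n5 by (simp add: presentation)

text \<open>Before the relaxation the spoke \<open>1\<close>, \<open>2\<close> is also present.\<close>

definition kin_hyperplanes :: "'a set set" where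
  "kin_hyperplanes = insert (V 1 \<union> V 2) hyperplanes"

lemma kin_hyperplanes_cases:
  assumes "H \<in> kin_hyperplanes"
  shows "(\<exists>i \<in> gaps. H = V 2 \<union> V i) \<or> (\<exists>j \<in> gaps. H = V (before j) \<union> V j)"
proof (cases "H \<in> hyperplanes")
  case True
  then show ?thesis using wheel_edge_cases unfolding hyperplanes_def by blast
next
  case False
  then have "H = V 2 \<union> V 1" using assms by (auto simp: kin_hyperplanes_def)
  then show ?thesis by (auto simp: gaps_def)
qed

lemma kin_hyperplanesI:
  "i \<in> gaps \<Longrightarrow> V 2 \<union> V i \<in> kin_hyperplanes" "j \<in> gaps \<Longrightarrow> V (before j) \<union> V j \<in> kin_hyperplanes"
proof -
  assume "i \<in> gaps"
  then have "i = 1 \<or> wheel_adj n 2 i" by (auto simp: gaps_def wheel_adj_def)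
  then show "V 2 \<union> V i \<in> kin_hyperplanes" by (auto simp: kin_hyperplanes_def hyperplanes_def)
qed (auto simp: kin_hyperplanes_def hyperplanes_def dest: before_adj)

lemma paving_kin: "paving E n kin_hyperplanes"
proof
  fix H H' assume H: "H \<in> kin_hyperplanes" "H' \<in> kin_hyperplanes" "H \<noteq> H'"
  have "\<exists>c d. c \<in> {1..n} \<and> d \<in> {1..n} \<and> H = V c \<union> V d" if "H \<in> kin_hyperplanes" for H
  proof -
    have "2 \<in> {1..n}" using n5 by simp
    then show ?thesis
      using kin_hyperplanes_cases[OF that] gap_range(9) gap_range(9)[OF gap_range(4)] by blast
  qed
  then obtain c d c' d' where "c \<in> {1..n}" "d \<in> {1..n}" "H = V c \<union> V d"
      "c' \<in> {1..n}" "d' \<in> {1..n}" "H' = V c' \<union> V d'" using H(1,2) by meson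
  then show "card (H \<inter> H' \<inter> E) + 2 \<le> n" using blocks_meet_card[of c d c' d'] H(3) by simp
qed (use finite_E n5 in auto)

text \<open>The hyperplane of a rim edge avoids the member of that edge and the member \<open>V 2\<close>; that of a
  spoke avoids the members of the two rim edges at its rim end. Either way only \<open>n - 1\<close> members are left.\<close>

lemma not_partial_transversal:
  assumes H: "H \<in> kin_hyperplanes" and X: "X \<subseteq> H" "card X = n"
  shows "\<not> partial_transversal {0..n} (kin_presentation n V) X"
proof
  assume "partial_transversal {0..n} (kin_presentation n V) X"
  then obtain f where f: "inj_on f X" "\<And>x. x \<in> X \<Longrightarrow> f x \<in> slots x"
    unfolding partial_transversal_def by auto
  obtain i j where ij: "i \<noteq> j" "i \<in> {0..n}" "j \<in> {0..n}" "\<And>x. x \<in> H \<Longrightarrow> i \<notin> slots x \<and> j \<notin> slots x"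
    using kin_hyperplanes_cases[OF H]
  proof (elim disjE bexE)
    fix k assume k: "k \<in> gaps" "H = V 2 \<union> V k"
    have a: "after k \<in> gaps" "before (after k) = k"
      using before_after[OF k(1) gap_range(6)[OF k(1)]] gap_range(6)[OF k(1)] by simp_all
    show ?thesis
    proof (rule that[of k "after k"])
      show "k \<notin> slots x \<and> after k \<notin> slots x" if "x \<in> H" for x
        using that k(2) slots_gap[OF k(1), of x] slots_gap[OF a(1), of x, unfolded a(2)] by blast
    qed (use gap_range(1,7)[OF k(1)] gap_range(1)[OF a(1)] in auto)
  next
    fix k assume k: "k \<in> gaps" "H = V (before k) \<union> V k"
    have r: "before k \<in> {1..n}" "before k \<noteq> 2" "k \<in> {1..n}" "k \<noteq> 2" "2 \<in> {1..n}"
      using gap_range[OF k(1)] gap_range[OF gap_range(4)[OF k(1)]] n5 by auto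
    show ?thesis
    proof (rule that[of k 2])
      show "k \<notin> slots x \<and> 2 \<notin> slots x" if "x \<in> H" for x
      proof -
        have "x \<in> V (before k) \<or> x \<in> V k" using that k(2) by blast
        then have "x \<notin> V 2"
          using block_unique[of x "before k" 2] block_unique[of x k 2] r by blast
        then show ?thesis using that k(2) slots_gap[OF k(1), of x] slots_2[of x] by blast
      qed
    qed (use gap_range(1,3)[OF k(1)] n5 in auto)
  qed
  have "f ` X \<subseteq> {0..n} - {i, j}"
  proof
    fix y assume "y \<in> f ` X"
    then obtain x where x: "x \<in> X" "y = f x" by blast
    then have "y \<in> slots x" "i \<notin> slots x" "j \<notin> slots x" using f(2) ij(4) X(1) by blast+
    then show "y \<in> {0..n} - {i, j}" by blast
  qed
  then have "card (f ` X) \<le> card ({0..n} - {i, j})" by (intro card_mono) auto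
  also have "\<dots> = n - 1" using ij by (simp add: card_Diff_subset)
  finally show False using card_image[OF f(1)] X(2) n5 by simp
qed

text \<open>The elements of \<open>Y\<close> outside \<open>V 2\<close> miss at most two members of the presentation if they lie in one
  block, at most one if they lie in the two blocks of a rim edge, and otherwise none. This
  does not count the member \<open>V 2\<close>, which is reached exactly if \<open>Y\<close> meets \<open>V 2\<close>. So the condition can only fail for \<open>n\<close> elements of
  one hyperplane.\<close>

lemma hall_condition:
  assumes X: "X \<subseteq> E" "card X \<le> n" and no: "card X = n \<Longrightarrow> \<forall>H\<in>kin_hyperplanes. \<not> X \<subseteq> H"
    and Y: "Y \<subseteq> X"
  shows "card Y \<le> card (\<Union>(slots ` Y))"
proof -
  let ?J = "\<Union>(slots ` Y)"
  have finX: "finite X" using finite_sub[OF X(1)] .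
  have finJ: "finite ?J" by (rule finite_subset[of _ "{0..n}"]) auto
  have JI: "j \<in> ?J" if "x \<in> Y" "j \<in> slots x" for x j using that by blast
  have J_le: "card Z \<le> card ?J" if "Z \<subseteq> ?J" for Z by (rule card_mono[OF finJ that])
  have r2: "2 \<in> {1..n}" using n5 by simp
  have cY: "card Y \<le> n" using card_mono[OF finX Y] X(2) by linarith
  have small: "card Y \<le> n - 1" if "Y \<subseteq> H" "H \<in> kin_hyperplanes" for H
  proof (rule ccontr)
    assume "\<not> ?thesis"
    then have "card Y = n" using cY by linarith
    then have "card X = n" "Y = X"
      using card_mono[OF finX Y] X(2) card_subset_eq[OF finX Y] by auto
    then show False using no that by blast
  qed
  consider "Y = {}" | "Y \<noteq> {}" "Y \<subseteq> V 2" | t where "t \<in> Y" "t \<notin> V 2" by blast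
  then show ?thesis
  proof cases
    case 2
    then obtain y where y: "y \<in> Y" "y \<in> V 2" by blast
    have "y \<in> E" using y Y X by blast
    then have "{0, 2} \<subseteq> ?J" using JI[OF y(1)] slots_0[of y] slots_2[of y] y(2) by blast
    from J_le[OF this] have "2 \<le> card ?J" by simp
    moreover have "card Y \<le> 2"
      using card_mono[OF finite_block[OF r2] 2(2)] card_block_2 by simp
    ultimately show ?thesis by linarith
  next
    case (3 t)
    have tE: "t \<in> E" using 3(1) Y X by blast
    then obtain i where i: "i \<in> {1..n}" "t \<in> V i" unfolding kin_ground_def by blast
    have ig: "i \<in> gaps"
    proof -
      have "i \<noteq> 2" using i(2) 3(2) by auto
      then show ?thesis using i(1) by (auto simp: gaps_def)
    qed
    have zero: "0 \<in> ?J" by (rule JI[OF 3(1)]) (use slots_0[of t] tE in blast)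
    have two: "2 \<in> ?J" if "y \<in> Y" "y \<in> V 2" for y
      by (rule JI[OF that(1)]) (use slots_2[of y] that(2) in blast)
    have other: "j \<in> ?J" if s: "s \<in> Y" "s \<in> V k" "k \<in> gaps" and j: "j \<in> gaps" "j \<noteq> k" "j \<noteq> after k" for s k j
    proof (rule JI[OF s(1)])
      have b: "before j \<noteq> k" using before_after[OF s(3) j(1)] j(3) by blast
      note rk = gap_range(9)[OF s(3)]
      have "s \<notin> V 2" using block_unique[OF s(2) _ rk r2] gap_range(3)[OF s(3)] by blast
      moreover have "s \<notin> V j" using block_unique[OF s(2) _ rk gap_range(9)[OF j(1)]] j(2) by blast
      moreover have "s \<notin> V (before j)"
        using block_unique[OF s(2) _ rk gap_range(9)[OF gap_range(4)[OF j(1)]]] b by blast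
      moreover have "s \<in> E" using s(1) Y X by blast
      ultimately show "j \<in> slots s" using slots_gap[OF j(1), of s] by blast
    qed
    have gap0: "0 \<notin> gaps" "2 \<notin> gaps" by (auto simp: gaps_def)
    have ai: "after i \<in> gaps" "after i \<noteq> i" using gap_range(6,7)[OF ig] .
    have J1: "insert 0 (gaps - {i, after i}) \<subseteq> ?J"
      using zero other[OF 3(1) i(2) ig] by blast
    have c1: "card (gaps - {i, after i}) = n - 3"
      using ig ai gaps_card by (simp add: card_Diff_subset)
    show ?thesis
    proof (cases "Y \<subseteq> V 2 \<union> V i")
      case True
      show ?thesis
      proof (cases "Y \<inter> V 2 = {}")
        case T: True
        then have "Y \<subseteq> V i" using True by blast
        then have "card Y \<le> n - 2"
          using card_mono[OF finite_block[OF i(1)], of Y] card_block_le[OF i(1)] by linarith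
        moreover have "card (insert 0 (gaps - {i, after i})) = n - 2"
          using c1 gap0 gaps_card(2) n5 by simp
        ultimately show ?thesis using J_le[OF J1] by linarith
      next
        case False
        then obtain y where "y \<in> Y" "y \<in> V 2" by blast
        then have "2 \<in> ?J" by (rule two)
        then have J3: "insert 2 (insert 0 (gaps - {i, after i})) \<subseteq> ?J" using J1 by blast
        moreover have "card (insert 2 (insert 0 (gaps - {i, after i}))) = n - 1"
          using c1 gap0 gaps_card(2) n5 by simp
        moreover have "card Y \<le> n - 1" by (rule small[OF True kin_hyperplanesI(1)[OF ig]])
        ultimately show ?thesis using J_le[OF J3] by linarith
      qed
    next
      case False
      then obtain s where s: "s \<in> Y" "s \<notin> V 2" "s \<notin> V i" by blast
      have "s \<in> E" using s(1) Y X by blast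
      then obtain k where k: "k \<in> {1..n}" "s \<in> V k" unfolding kin_ground_def by blast
      have kg: "k \<in> gaps"
      proof -
        have "k \<noteq> 2" using k(2) s(2) by auto
        then show ?thesis using k(1) by (auto simp: gaps_def)
      qed
      have "k \<noteq> i" using k(2) s(3) by auto
      \<comment> \<open>The only member of the presentation, apart from \<open>V 2\<close>, that may avoid both \<open>s\<close> and \<open>t\<close>.\<close>
      define g where "g = (if k = after i then k else i)"
      have gg: "g \<in> gaps" using kg ig ai(1) by (simp add: g_def)
      have J2: "insert 0 (gaps - {g}) \<subseteq> ?J"
      proof -
        have "j \<in> ?J" if j: "j \<in> gaps" "j \<noteq> g" for j
        proof (cases "j = i \<or> j = after i")
          case False
          then show ?thesis using J1 j(1) by blast
        next
          case True
          have "j \<noteq> k \<and> j \<noteq> after k"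
            using True j(2) \<open>k \<noteq> i\<close> gap_range(8)[OF ig] before_after[OF ig ai(1)] before_after[OF kg ai(1)]
            unfolding g_def by (auto split: if_splits)
          then show ?thesis using other[OF s(1) k(2) kg j(1)] by blast
        qed
        then show ?thesis using zero by blast
      qed
      have c2: "card (insert 0 (gaps - {g})) = n - 1"
        using gg gap0 gaps_card n5 by simp
      show ?thesis
      proof (cases "?J \<subseteq> insert 0 (gaps - {g})")
        case True
        have "Y \<subseteq> V (before g) \<union> V g"
        proof
          fix y assume y: "y \<in> Y"
          have "g \<notin> ?J" "2 \<notin> ?J" using True gap0 gg gap_range(2)[OF gg] by auto
          then have "g \<notin> slots y" "2 \<notin> slots y" using JI[OF y] by blast+
          moreover have "y \<in> E" using y Y X by blast
          ultimately show "y \<in> V (before g) \<union> V g"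
            using slots_gap[OF gg, of y] slots_2[of y] by blast
        qed
        from small[OF this kin_hyperplanesI(2)[OF gg]] show ?thesis using J_le[OF J2] c2 by linarith
      next
        case False
        then obtain z where z: "z \<in> ?J" "z \<notin> insert 0 (gaps - {g})" by blast
        have "card (insert z (insert 0 (gaps - {g}))) = n"
          using card_insert_disjoint[OF _ z(2)] c2 gaps_card(2) n5 by simp
        moreover have J3: "insert z (insert 0 (gaps - {g})) \<subseteq> ?J" using z(1) J2 by blast
        ultimately show ?thesis using J_le[OF J3] cY by linarith
      qed
    qed
  qed simp
qed

lemma Kin_eq: "Kin n V = paving_matroid E n kin_hyperplanes"
proof -
  have "partial_transversal {0..n} (kin_presentation n V) X \<longleftrightarrow>
      (card X = n \<longrightarrow> (\<forall>H\<in>kin_hyperplanes. \<not> X \<subseteq> H))" if X: "X \<subseteq> E" "card X \<le> n" for X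
  proof
    assume "partial_transversal {0..n} (kin_presentation n V) X"
    then show "card X = n \<longrightarrow> (\<forall>H\<in>kin_hyperplanes. \<not> X \<subseteq> H)" using not_partial_transversal by blast
  next
    assume no: "card X = n \<longrightarrow> (\<forall>H\<in>kin_hyperplanes. \<not> X \<subseteq> H)"
    have "\<exists>f. inj_on f X \<and> (\<forall>x\<in>X. f x \<in> slots x)"
    proof (rule hall)
      show "finite X" by (rule finite_sub[OF X(1)])
      show "card Y \<le> card (\<Union>(slots ` Y))" if "Y \<subseteq> X" for Y
        by (rule hall_condition[OF X _ that]) (use no in blast)
    qed simp
    then show "partial_transversal {0..n} (kin_presentation n V) X"
      unfolding partial_transversal_def by auto
  qed
  then show ?thesis
    unfolding Kin_def truncate_to_def transversal_matroid_def paving_matroid_def by auto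
qed

text \<open>All bases of a paving matroid with a basis of \<open>n\<close> elements have \<open>n\<close> elements, and removing a
  hyperplane of exactly \<open>n\<close> elements from the list turns this one set into a basis.\<close>

lemma Kin_minus_eq: "Kin_minus n V = paving_matroid E n hyperplanes"
proof -
  interpret kin: paving E n kin_hyperplanes by (rule paving_kin)
  let ?K = "paving_matroid E n kin_hyperplanes"
  have r: "1 \<in> {1..n}" "2 \<in> {1..n}" "3 \<in> {1..n}" "4 \<in> {1..n}" using n5 by auto
  have V12: "V 1 \<union> V 2 \<subseteq> E" by (rule two_blocks_subset[OF r(1,2)])
  have c12: "card (V 1 \<union> V 2) = n"
    using card_two_blocks[OF r(1,2)] card_block[OF r(1)] card_block_2 n5 by simp
  have not12: "\<not> V 1 \<union> V 2 \<subseteq> H" if H: "H \<in> hyperplanes" for H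
  proof
    assume a: "V 1 \<union> V 2 \<subseteq> H"
    obtain c d where cd: "wheel_adj n c d" "H = V c \<union> V d" using H unfolding hyperplanes_def by blast
    have "(V 1 \<union> V 2) \<inter> V 1 \<noteq> {}" "(V 1 \<union> V 2) \<inter> V 2 \<noteq> {}"
      using block_nonempty[OF r(1)] block_nonempty[OF r(2)] by blast+
    then have "wheel_adj n 1 2" using adj_if_meet[OF cd(1) a[unfolded cd(2)] _ _ r(1,2)] by simp
    then show False using adj_range(5) by blast
  qed
  \<comment> \<open>A set that meets three blocks lies in no hyperplane.\<close>
  obtain J where J: "J \<in> indeps ?K" "card J = n"
  proof -
    obtain x y where xy: "x \<in> V 3" "y \<in> V 4"
      using block_nonempty[OF r(3)] block_nonempty[OF r(4)] by blast
    have out: "x \<notin> V 1" "y \<notin> V 1" "x \<noteq> y"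
      using block_unique[OF xy(1) _ r(3,1)] block_unique[OF xy(2) _ r(4,1)]
        block_unique[OF xy(1) _ r(3,4)] xy(2) by auto
    let ?J = "insert x (insert y (V 1))"
    have "card ?J = n" using out finite_block[OF r(1)] card_block[OF r(1)] n5 by simp
    moreover have "?J \<subseteq> E" using xy block_subset[OF r(1)] block_subset[OF r(3)] block_subset[OF r(4)] by blast
    moreover have "\<not> ?J \<subseteq> H" if H: "H \<in> kin_hyperplanes" for H
    proof
      assume a: "?J \<subseteq> H"
      obtain z where z: "z \<in> V 1" using block_nonempty[OF r(1)] by blast
      have "\<exists>c d. c \<in> {1..n} \<and> d \<in> {1..n} \<and> H = V c \<union> V d"
        using kin_hyperplanes_cases[OF H] gap_range(9) gap_range(9)[OF gap_range(4)] r(2) by blast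
      then obtain c d where cd: "c \<in> {1..n}" "d \<in> {1..n}" "H = V c \<union> V d" by blast
      have "3 = c \<or> 3 = d" using a xy(1) cd block_unique[OF xy(1) _ r(3)] by blast
      moreover have "4 = c \<or> 4 = d" using a xy(2) cd block_unique[OF xy(2) _ r(4)] by blast
      moreover have "1 = c \<or> 1 = d" using a z cd block_unique[OF z _ r(1)] by blast
      ultimately show False by auto
    qed
    ultimately show ?thesis using that[of ?J] by (simp add: indeps_paving)
  qed
  have bases: "bases ?K = {B \<in> indeps ?K. card B = n}"
  proof -
    have "card B = n" if B: "B \<in> bases ?K" for B
    proof -
      have Bi: "B \<in> indeps ?K" and mx: "\<And>I. I \<in> indeps ?K \<Longrightarrow> B \<subseteq> I \<Longrightarrow> I = B"
        using B unfolding bases_def by simp_all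
      have "card B \<le> n" using Bi by (simp add: indeps_paving)
      then obtain B' where "B' \<in> indeps ?K" "B \<subseteq> B'" "card B' = n"
        using matroid_extend[OF kin.is_matroid_paving Bi J(1)] J(2) by auto
      then show ?thesis using mx by blast
    qed
    moreover have "B \<in> bases ?K" if B: "B \<in> indeps ?K" "card B = n" for B
    proof -
      have "I = B" if I: "I \<in> indeps ?K" "B \<subseteq> I" for I
      proof -
        have "finite I" "card I \<le> n" using I(1) finite_sub[of I] by (simp_all add: indeps_paving)
        then show ?thesis using card_seteq[of I B] I(2) B(2) by simp
      qed
      then show ?thesis using B(1) by (simp add: bases_def)
    qed
    moreover have "bases ?K \<subseteq> indeps ?K" unfolding bases_def by blast
    ultimately show ?thesis by blast
  qed
  have "(\<exists>B \<in> insert (V 1 \<union> V 2) (bases ?K). I \<subseteq> B) \<longleftrightarrow> I \<in> indeps (paving_matroid E n hyperplanes)" for I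
  proof
    assume "\<exists>B \<in> insert (V 1 \<union> V 2) (bases ?K). I \<subseteq> B"
    then obtain B where IB: "I \<subseteq> B" and B: "B = V 1 \<union> V 2 \<or> B \<in> bases ?K" by blast
    have B': "B \<subseteq> E \<and> card B = n \<and> (\<forall>H\<in>hyperplanes. \<not> B \<subseteq> H)"
    proof (cases "B = V 1 \<union> V 2")
      case True
      show ?thesis unfolding True using V12 c12 not12 by blast
    next
      case False
      then have "B \<in> indeps ?K" "card B = n" using B unfolding bases by blast+
      then show ?thesis unfolding indeps_paving kin_hyperplanes_def by blast
    qed
    have fB: "finite B" by (rule finite_sub) (use B' in blast)
    have "I = B" if "card I = n" using card_subset_eq[OF fB IB] that B' by simp
    then show "I \<in> indeps (paving_matroid E n hyperplanes)"
      using card_mono[OF fB IB] B' IB unfolding indeps_paving by auto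
  next
    assume I: "I \<in> indeps (paving_matroid E n hyperplanes)"
    show "\<exists>B \<in> insert (V 1 \<union> V 2) (bases ?K). I \<subseteq> B"
    proof (cases "I \<subseteq> V 1 \<union> V 2")
      case False
      then have Ik: "I \<in> indeps ?K" using I by (simp add: indeps_paving kin_hyperplanes_def)
      moreover have "card I \<le> card J" using I J(2) by (simp add: indeps_paving)
      ultimately obtain B where "B \<in> indeps ?K" "I \<subseteq> B" "card B = card J"
        using matroid_extend[OF kin.is_matroid_paving _ J(1)] by blast
      then show ?thesis using J(2) by (auto simp: bases)
    qed blast
  qed
  then show ?thesis
    unfolding Kin_minus_def relaxation_def Kin_eq matroid_of_bases_def
    by (simp add: paving_matroid_def)
qed

section \<open>Membership in the Kinser classes\<close>

lemma kinser_inequality_Kin_minus: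
  assumes "4 \<le> m" "\<And>i. i \<in> {1..m} \<Longrightarrow> X i \<subseteq> E"
  shows "kinser_inequality m (Kin_minus n V) X \<longleftrightarrow> 0 \<le> slack (X 2) (X 1) (map X [3..<Suc m])"
  unfolding Kin_minus_eq
  by (rule kinser_inequality_iff_slack[OF submodular_rank_axioms assms rank_paving])

end

theorem lemma4p3:
  fixes V :: "nat \<Rightarrow> 'a set" and n :: nat
  assumes "n \<ge> 5" and "kinser_blocks n V"
  shows "Kin_minus n V \<in> kinser_class (n - 1) - kinser_class n"
proof -
  interpret kinser_configuration n V using assms by unfold_locales
  have ground: "ground (Kin_minus n V) = E"
    unfolding Kin_minus_eq by (simp add: paving_matroid_def)
  have "kinser_inequality (n - 1) (Kin_minus n V) X"
    if X: "\<forall>i \<in> {1..n - 1}. X i \<subseteq> ground (Kin_minus n V)" for X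
  proof -
    have sub: "X i \<subseteq> E" if "1 \<le> i" "i < n" for i using X[unfolded ground] that by simp
    have "0 \<le> slack (X 2) (X 1) (map X [3..<Suc (n - 1)])"
    proof (rule slack_nonneg)
      show "\<forall>x\<in>set (map X [3..<Suc (n - 1)]). x \<subseteq> E"
      proof
        fix x assume "x \<in> set (map X [3..<Suc (n - 1)])"
        then obtain i where "x = X i" "i \<in> {3..<Suc (n - 1)}"
          unfolding set_map set_upt by (elim imageE)
        then show "x \<subseteq> E" using sub[of i] n5 by simp
      qed
    qed (use sub n5 in simp_all)
    then show ?thesis using kinser_inequality_Kin_minus[of "n - 1" X] X[unfolded ground] n5 by simp
  qed
  moreover have "is_matroid (Kin_minus n V)"
    unfolding Kin_minus_eq by (rule is_matroid_paving)
  ultimately have "Kin_minus n V \<in> kinser_class (n - 1)"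
    unfolding kinser_class_def by (intro CollectI conjI allI impI)
  moreover have "Kin_minus n V \<notin> kinser_class n"
  proof -
    have "\<not> kinser_inequality n (Kin_minus n V) V"
      using kinser_inequality_Kin_minus[of n V] slack_blocks block_subset n5 by simp
    moreover have "\<forall>i \<in> {1..n}. V i \<subseteq> ground (Kin_minus n V)"
      unfolding ground using block_subset by blast
    ultimately show ?thesis unfolding kinser_class_def mem_Collect_eq by blast
  qed
  ultimately show ?thesis by blast
qed

end
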